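(* Let $d\ge2$ be an integer, let $\varphi$ be the Laplace transform of a strictly positive random variable, let $j\ge0$ and $k\ge1$ be integers, and let $\Theta\subset(0,\infty)$. For each $\theta\in\Theta$ let $\mathbf{Y}_{\theta,1},\mathbf{Y}_{\theta,2},\dots$ be i.i.d. random vectors in $\mathbb{R}^d$, put $\mathbf{M}_{\theta,m}=\vee\{\mathbf{Y}_{\theta,1},\dots,\mathbf{Y}_{\theta,m}\}$ (componentwise maximum) for integers $m\ge1$, and let $N_\theta$ be a non-negative integer-valued random variable, independent of $\{\mathbf{Y}_{\theta,i}\}_{i\ge1}$, with probability generating function $P_\theta(s)=s^j\varphi\{(1-s^k)/\theta\}$, $0<s<1$. Let $\theta_n\in\Theta$ with $\theta_n\downarrow0$ as $n\to\infty$, and let $\{k_n\}$ be a sequence of positive integers such that $\mathbf{M}_{\theta_n,k_n}\xrightarrow{d}\mathbf{V}$ as $n\to\infty$, where $\mathbf{V}$ is max-infinitely divisible. Then the limit law, as $n\to\infty$, of the $N_\theta$-maxima $\mathbf{M}_{\theta_n,N_{\theta_n}}=\vee\{\mathbf{Y}_{\theta_n,1},\dots,\mathbf{Y}_{\theta_n,N_{\theta_n}}\}$ is necessarily a $\varphi$-mixture of a max-infinitely divisible law; that is, if $\mathbf{M}_{\theta_n,N_{\theta_n}}$ converges in distribution to some law on $\mathbb{R}^d$, then the distribution function of that law is $\varphi\{-\log H\}$ for some max-infinitely divisible distribution function $H$ on $\mathbb{R}^d$.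
   Context: The Laplace transform of a random variable $Z>0$ is $\varphi(v)=E[e^{-vZ}]$, $v\ge0$. For every $\theta>0$ and integers $j\ge0$, $k\ge1$, the function $s^j\varphi\{(1-s^k)/\theta\}$ is a probability generating function. A distribution function $H$ on $\mathbb{R}^d$ is max-infinitely divisible (MID) iff $H^s$ is a distribution function on $\mathbb{R}^d$ for every $s>0$; a random vector is MID if its distribution function is. The $\varphi$-mixture of the MID law with distribution function $H$ is the law with distribution function $x\mapsto\varphi(-\log H(x))$, read as $0$ where $H(x)=0$. An empty maximum ($N_\theta=0$) is taken to be $-\infty$ in every coordinate, so that $P\{\mathbf{M}_{\theta,N_\theta}\le x\}=P_\theta(P\{\mathbf{Y}_{\theta,1}\le x\})$; convergence in distribution means convergence of these functions to the limiting distribution function at its continuity points. *)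

theory Defs
  imports "HOL-Probability.Probability"
begin

text \<open>
  The order on \<^typ>\<open>real ^ 'n\<close> is componentwise, so the interval below is the lower
  orthant at \<open>x\<close>.
\<close>

definition joint_cdf :: "(real ^ 'n::finite) measure \<Rightarrow> real ^ 'n \<Rightarrow> real" where
  "joint_cdf \<mu> x = measure \<mu> {..x}"

definition is_joint_cdf :: "(real ^ 'n::finite \<Rightarrow> real) \<Rightarrow> bool" where
  "is_joint_cdf F \<longleftrightarrow> (\<exists>\<mu>. prob_space \<mu> \<and> sets \<mu> = sets borel \<and> F = joint_cdf \<mu>)"

definition max_inf_divisible :: "(real ^ 'n::finite \<Rightarrow> real) \<Rightarrow> bool" where
  "max_inf_divisible H \<longleftrightarrow>
     is_joint_cdf H \<and> (\<forall>s>0. is_joint_cdf (\<lambda>x. H x powr s))"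

definition laplace_transform :: "'a measure \<Rightarrow> ('a \<Rightarrow> real) \<Rightarrow> real \<Rightarrow> real" where
  "laplace_transform R Z v = (\<integral>\<omega>. exp (- v * Z \<omega>) \<partial>R)"

definition laplace_mixture :: "(real \<Rightarrow> real) \<Rightarrow> ('b \<Rightarrow> real) \<Rightarrow> 'b \<Rightarrow> real" where
  "laplace_mixture \<phi> H x = (if H x = 0 then 0 else \<phi> (- ln (H x)))"

text \<open>
  Componentwise maximum of \<open>Y 1, \<dots>, Y m\<close>. Values are extended reals, so that for \<open>m = 0\<close>
  every coordinate is the supremum of the empty set, which is \<open>-\<infinity>\<close>.
\<close>

definition vec_maximum ::
  "(nat \<Rightarrow> 'a \<Rightarrow> real ^ 'n::finite) \<Rightarrow> nat \<Rightarrow> 'a \<Rightarrow> ereal ^ 'n" where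
  "vec_maximum Y m \<omega> = (\<chi> i. SUP l\<in>{1..m}. ereal (Y l \<omega> $ i))"

lemma vec_maximum_0: "vec_maximum Y 0 \<omega> $ i = - \<infinity>"
  by (simp add: vec_maximum_def bot_ereal_def)

lemma vec_maximum_pos:
  assumes "m \<ge> 1"
  shows "vec_maximum Y m \<omega> $ i = ereal (Max ((\<lambda>l. Y l \<omega> $ i) ` {1..m}))"
proof -
  let ?A = "(\<lambda>l. Y l \<omega> $ i) ` {1..m}"
  have A: "finite ?A" "?A \<noteq> {}"
    using assms by auto
  have "ereal (Max ?A) = Max (ereal ` ?A)"
    by (rule mono_Max_commute) (use A in \<open>auto simp: mono_def\<close>)
  also have "\<dots> = Sup (ereal ` ?A)"
    by (rule Max_Sup) (use A in auto)
  finally show ?thesis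
    by (simp add: vec_maximum_def image_image)
qed

text \<open>
  Heterogeneous version of \<^const>\<open>prob_space.indep_var\<close>, which requires both random
  elements to have the same type.
\<close>

definition indep_elements ::
  "'a measure \<Rightarrow> 'b measure \<Rightarrow> ('a \<Rightarrow> 'b) \<Rightarrow> 'c measure \<Rightarrow> ('a \<Rightarrow> 'c) \<Rightarrow> bool" where
  "indep_elements M S X T Y \<longleftrightarrow>
     X \<in> measurable M S \<and> Y \<in> measurable M T \<and>
     prob_space.indep_set M {X -` A \<inter> space M | A. A \<in> sets S} {Y -` B \<inter> space M | B. B \<in> sets T}"

definition ext_joint_cdf ::
  "'a measure \<Rightarrow> ('a \<Rightarrow> ereal ^ 'n::finite) \<Rightarrow> real ^ 'n \<Rightarrow> real" where
  "ext_joint_cdf M W x = measure M {\<omega> \<in> space M. \<forall>i. W \<omega> $ i \<le> ereal (x $ i)}"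

definition cdf_converges ::
  "(nat \<Rightarrow> real ^ 'n::finite \<Rightarrow> real) \<Rightarrow> (real ^ 'n \<Rightarrow> real) \<Rightarrow> bool" where
  "cdf_converges F G \<longleftrightarrow> (\<forall>x. isCont G x \<longrightarrow> (\<lambda>n. F n x) \<longlonglongrightarrow> G x)"

end

theory Submission imports Defs begin

text \<open>
  Let \<open>\<psi>(u) = E[u\<^sup>Z]\<close>, an increasing homeomorphism of \<open>[0, 1]\<close> with \<open>\<phi>(v) = \<psi>(e\<^sup>-\<^sup>v)\<close>, let \<open>G\<close> be
  the limiting distribution function and \<open>H = \<psi>\<^sup>-\<^sup>1(G)\<close>, so that \<open>G = \<phi>(-log H)\<close>. If \<open>F\<^sub>n\<close> is the
  distribution function of a single \<open>Y\<close>, convergence of \<open>F\<^sub>n\<^sup>j \<phi>((1 - F\<^sub>n\<^sup>k) / \<theta>\<^sub>n)\<close> to \<open>G\<close> forces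
  \<open>(1 - F\<^sub>n\<^sup>k) / \<theta>\<^sub>n \<rightarrow> -log H\<close>; hence for every \<open>s > 0\<close> the distribution functions \<open>F\<^sub>n\<^sup>m\<close> with
  \<open>m = \<lceil>s k / \<theta>\<^sub>n\<rceil>\<close> converge to \<open>H\<^sup>s\<close>. As \<open>H\<^sup>s\<close> inherits right continuity and the boundary limits
  from \<open>G\<close>, it is a distribution function.

  That such a limit comes from a measure on \<open>\<real>\<^sup>d\<close> is reduced to Helly's theorem on the line: a
  space-filling curve is a continuous map of \<open>[0, 1]\<close> onto a cube with a Borel section, so weakly
  convergent subsequences can be extracted for the measures lifted to \<open>[0, 1]\<close> and pushed back.
\<close>

subsection \<open>A space-filling curve with a Borel section\<close>

text \<open>
  Schoenberg's curve reads the binary digits of the coordinates off the ternary digits of \<open>t\<close>. Any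
  continuous function of period 2 that is 0 on \<open>[0, 1/3]\<close> and 1 on \<open>[2/3, 1]\<close> would serve as the wave.
\<close>

definition schoenberg_wave :: "real \<Rightarrow> real" where
  "schoenberg_wave u = min 1 (max 0 (1 / 2 - cos (pi * u)))"

text \<open>The code \<open>to_nat (i, k)\<close> gives binary digit \<open>k\<close> of coordinate
  \<open>i\<close> a ternary position of its own, so the digits of all coordinates can be prescribed
  independently.\<close>

definition peano_curve :: "real \<Rightarrow> real ^ 'n::finite" where
  "peano_curve t = (\<chi> i. \<Sum>k. schoenberg_wave (3 ^ to_nat (i, k) * t) / 2 ^ Suc k)"

lemma schoenberg_wave_bounds: "0 \<le> schoenberg_wave u" "schoenberg_wave u \<le> 1"
  by (auto simp: schoenberg_wave_def)

text \<open>All ternary digits of \<open>t\<close> are 0 or 2. Hence \<open>3 ^ m * t\<close> is an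
  even integer, which the period 2 of the wave removes, plus \<open>2 * a m / 3 + r\<close> with
  \<open>r\<close> in [0, 1/3]. This remainder falls into one of the two intervals on which the wave
  is constant.\<close>

lemma schoenberg_wave_ternary_digit:
  fixes a :: "nat \<Rightarrow> nat"
  assumes a: "\<And>m. a m \<le> 1"
  defines "t \<equiv> \<Sum>m. 2 * real (a m) / 3 ^ Suc m"
  shows "schoenberg_wave (3 ^ m * t) = real (a m)" and "0 \<le> t" and "t \<le> 1"
proof -
  define f where "f m = 2 * real (a m) / 3 ^ Suc m" for m
  have geo: "(\<lambda>n. c * (1 / 3) ^ n) sums (c * (3 / 2))" for c :: real
    using sums_mult[OF geometric_sums[of "1 / 3 :: real"], of c] by simp
  have f_le: "f m \<le> 2 / 3 * (1 / 3) ^ m" for m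
    using a[of m] by (simp add: f_def power_divide divide_simps)
  have f_nonneg: "0 \<le> f m" for m
    by (simp add: f_def)
  have f: "summable f"
    by (rule summable_comparison_test'[where g = "\<lambda>m. 2 / 3 * (1 / 3) ^ m" and N = 0])
       (use geo[of "2 / 3"] f_le f_nonneg in \<open>auto simp: sums_iff\<close>)
  have t: "t = suminf f"
    unfolding t_def f_def ..
  show "0 \<le> t"
    unfolding t by (intro suminf_nonneg f f_nonneg)
  have "suminf f \<le> 1"
    using suminf_le[OF f_le f] geo[of "2 / 3"] by (auto simp: sums_iff)
  then show "t \<le> 1" using t by simp
  \<comment> \<open>The digits after position \<open>m\<close> contribute \<open>r\<close> to
    \<open>3 ^ m * t\<close>; the extreme case of all digits 2 gives the geometric sum 1/3.\<close>
  define r where "r = 3 ^ m * (\<Sum>n. f (n + Suc m))"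
  have fs: "summable (\<lambda>n. f (n + Suc m))"
    using f by (subst summable_iff_shift)
  have r0: "0 \<le> r"
    unfolding r_def by (intro mult_nonneg_nonneg suminf_nonneg fs f_nonneg) auto
  have "r = (\<Sum>n. 3 ^ m * f (n + Suc m))"
    unfolding r_def using fs by (rule suminf_mult[symmetric])
  also have "\<dots> \<le> 2 / 9 * (3 / 2)"
  proof -
    have "3 ^ m * f (n + Suc m) \<le> 2 / 9 * (1 / 3) ^ n" for n
      using a[of "n + Suc m"] by (simp add: f_def power_divide power_add divide_simps)
    from suminf_le[OF this summable_mult[OF fs]] show ?thesis
      using geo[of "2 / 9"] by (auto simp: sums_iff)
  qed
  finally have r1: "r \<le> 1 / 3" by simp
  have "3 ^ m * t = 3 ^ m * (\<Sum>i<m. f i) + 3 ^ m * f m + r"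
    using suminf_split_initial_segment[OF f, of "Suc m"] by (simp add: t r_def algebra_simps)
  also have "3 ^ m * (\<Sum>i<m. f i) = 2 * real (\<Sum>i<m. a i * 3 ^ (m - Suc i))"
  proof -
    have "3 ^ m * f i = 2 * (real (a i) * 3 ^ (m - Suc i))" if "i < m" for i
    proof -
      have "(3::real) ^ m = 3 ^ (m - Suc i) * 3 ^ Suc i"
        using that by (subst power_add[symmetric]) simp
      then show ?thesis by (simp add: f_def)
    qed
    then show ?thesis
      by (simp add: sum_distrib_left)
  qed
  also have "3 ^ m * f m = 2 * real (a m) / 3"
    by (simp add: f_def)
  finally have decomp: "pi * (3 ^ m * t)
      = pi * (2 * real (a m) / 3 + r) + 2 * pi * real (\<Sum>i<m. a i * 3 ^ (m - Suc i))"
    by (simp add: algebra_simps)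
  have period: "cos (x + 2 * pi * real K) = cos x" for x and K :: nat
    using cos_2npi[of K] sin_2npi[of K] by (simp add: cos_add mult.assoc mult.commute[of pi])
  have cos_eq: "cos (pi * (3 ^ m * t)) = cos (pi * (2 * real (a m) / 3 + r))"
    unfolding decomp by (rule period)
  consider "a m = 0" | "a m = 1"
    using a[of m] by linarith
  then show "schoenberg_wave (3 ^ m * t) = real (a m)"
  proof cases
    case 1
    \<comment> \<open>For \<open>r\<close> in [0, 1/3] the cosine is at least 1/2 and the clipping
      in the wave gives 0. In the other case the argument lies in [2/3, 1], the cosine is at most
      -1/2 and the clipping gives 1.\<close>
    have "cos (pi / 3) \<le> cos (pi * r)"
      by (rule cos_monotone_0_pi_le) (use r0 r1 in auto)
    then show ?thesis
      unfolding schoenberg_wave_def cos_eq using 1 by (simp add: cos_60)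
  next
    case 2
    have "cos (pi * (2 / 3 + r)) \<le> cos (2 * pi / 3)"
    proof (rule cos_monotone_0_pi_le)
      show "pi * (2 / 3 + r) \<le> pi"
        using r1 mult_left_mono[of "2 / 3 + r" 1 pi] by simp
      show "2 * pi / 3 \<le> pi * (2 / 3 + r)"
        using r0 by (simp add: algebra_simps)
    qed auto
    also have "cos (2 * pi / 3) = - (1 / 2)"
      by (simp add: cos_120 cos_120')
    finally show ?thesis
      unfolding schoenberg_wave_def cos_eq using 2 by simp
  qed
qed

text \<open>Taking as digit the excess of \<lfloor>2y\<rfloor> over 2\<lfloor>y\<rfloor> for
  \<open>y = 2 ^ k * x\<close> makes the partial sums telescope to \<lfloor>2^n x\<rfloor> / 2^n,
  which is within 2^(-n) of \<open>x\<close>.\<close>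

lemma binary_expansion:
  fixes x :: real
  assumes "0 \<le> x" "x < 1"
  obtains b :: "nat \<Rightarrow> nat" where "\<And>k. b k \<le> 1" "(\<lambda>k. real (b k) / 2 ^ Suc k) sums x"
proof -
  define b where "b k = nat (\<lfloor>2 ^ Suc k * x\<rfloor> - 2 * \<lfloor>2 ^ k * x\<rfloor>)" for k
  have floor_double: "2 * \<lfloor>y\<rfloor> \<le> \<lfloor>2 * y\<rfloor>" "\<lfloor>2 * y\<rfloor> \<le> 2 * \<lfloor>y\<rfloor> + 1" for y :: real
    by linarith+
  have b_le: "b k \<le> 1" for k
    using floor_double[of "2 ^ k * x"] by (simp add: b_def mult.assoc)
  \<comment> \<open>The first half of \<open>floor_double\<close> makes the argument of
    \<open>nat\<close> non-negative, so the truncation changes nothing.\<close>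
  have b_real: "real (b k) = real_of_int \<lfloor>2 ^ Suc k * x\<rfloor> - 2 * real_of_int \<lfloor>2 ^ k * x\<rfloor>" for k
    using floor_double[of "2 ^ k * x"] by (simp add: b_def mult.assoc)
  have psum: "(\<Sum>k<n. real (b k) / 2 ^ Suc k) = real_of_int \<lfloor>2 ^ n * x\<rfloor> / 2 ^ n" for n
  proof (induction n)
    case 0
    have "\<lfloor>x\<rfloor> = 0" using assms by linarith
    then show ?case by simp
  next
    case (Suc n)
    then show ?case by (simp add: b_real field_simps)
  qed
  have "(\<lambda>n. real_of_int \<lfloor>2 ^ n * x\<rfloor> / 2 ^ n) \<longlonglongrightarrow> x"
  proof (rule tendsto_sandwich)
    show "(\<lambda>n. x - (1 / 2) ^ n) \<longlonglongrightarrow> x"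
      using tendsto_diff[OF tendsto_const LIMSEQ_realpow_zero[of "1 / 2 :: real"], of x] by simp
    show "eventually (\<lambda>n. x - (1 / 2) ^ n \<le> real_of_int \<lfloor>2 ^ n * x\<rfloor> / 2 ^ n) sequentially"
    proof (intro always_eventually allI)
      fix n
      have "2 ^ n * x - 1 \<le> real_of_int \<lfloor>2 ^ n * x\<rfloor>" by linarith
      then have "(2 ^ n * x - 1) / 2 ^ n \<le> real_of_int \<lfloor>2 ^ n * x\<rfloor> / 2 ^ n"
        by (rule divide_right_mono) simp
      then show "x - (1 / 2) ^ n \<le> real_of_int \<lfloor>2 ^ n * x\<rfloor> / 2 ^ n"
        by (simp add: diff_divide_distrib power_divide)
    qed
    show "eventually (\<lambda>n. real_of_int \<lfloor>2 ^ n * x\<rfloor> / 2 ^ n \<le> x) sequentially"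
      by (auto simp: divide_simps mult.commute)
  qed (rule tendsto_const)
  then have "(\<lambda>k. real (b k) / 2 ^ Suc k) sums x"
    unfolding sums_def psum .
  with b_le show ?thesis using that by blast
qed

lemma continuous_on_peano_curve: "continuous_on A (peano_curve :: real \<Rightarrow> real ^ 'n::finite)"
proof -
  have "continuous_on UNIV (\<lambda>t. \<Sum>k. schoenberg_wave (3 ^ to_nat (i, k) * t) / 2 ^ Suc k)"
    for i :: 'n
  proof (rule uniform_limit_theorem)
    show "uniform_limit UNIV
        (\<lambda>n t. \<Sum>k<n. schoenberg_wave (3 ^ to_nat (i, k) * t) / 2 ^ Suc k)
        (\<lambda>t. \<Sum>k. schoenberg_wave (3 ^ to_nat (i, k) * t) / 2 ^ Suc k) sequentially"
    proof (rule Weierstrass_m_test)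
      show "norm (schoenberg_wave (3 ^ to_nat (i, k) * t) / 2 ^ Suc k) \<le> (1 / 2) ^ Suc k" for k t
        using schoenberg_wave_bounds[of "3 ^ to_nat (i, k) * t"]
        by (simp add: power_divide divide_simps)
      show "summable (\<lambda>k. (1 / 2 :: real) ^ Suc k)"
        using summable_geometric[of "1 / 2 :: real"] summable_ignore_initial_segment[of _ 1] by force
    qed
    show "\<forall>\<^sub>F n in sequentially. continuous_on UNIV
        (\<lambda>t. \<Sum>k<n. schoenberg_wave (3 ^ to_nat (i, k) * t) / 2 ^ Suc k)"
      unfolding schoenberg_wave_def by (intro always_eventually allI continuous_intros) auto
  qed auto
  then have "continuous_on UNIV (peano_curve :: real \<Rightarrow> real ^ 'n)"
    unfolding peano_curve_def by (intro continuous_on_vec_lambda)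
  then show ?thesis
    by (rule continuous_on_subset) simp
qed

lemma peano_curve_covers:
  fixes x :: "real ^ 'n::finite"
  assumes x: "\<And>i. 0 \<le> x $ i" "\<And>i. x $ i < 1"
  shows "x \<in> peano_curve ` {0..1}"
proof -
  have "\<exists>b :: nat \<Rightarrow> nat. (\<forall>k. b k \<le> 1) \<and> (\<lambda>k. real (b k) / 2 ^ Suc k) sums (x $ i)" for i
    using binary_expansion[OF x[of i]] by metis
  then obtain b :: "'n \<Rightarrow> nat \<Rightarrow> nat" where b: "\<And>i k. b i k \<le> 1"
    "\<And>i. (\<lambda>k. real (b i k) / 2 ^ Suc k) sums (x $ i)"
    by metis
  \<comment> \<open>Position \<open>m\<close> receives the digit whose code is \<open>m\<close>. If
    \<open>m\<close> is no code, \<open>from_nat m\<close> is still some pair and the value is still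
    0 or 1, which suffices.\<close>
  define a where "a m = case_prod b (from_nat m)" for m
  define t where "t = (\<Sum>m. 2 * real (a m) / 3 ^ Suc m)"
  have a: "a m \<le> 1" for m
    using b(1) by (simp add: a_def split: prod.split)
  have digit: "schoenberg_wave (3 ^ m * t) = real (a m)" "0 \<le> t" "t \<le> 1" for m
    unfolding t_def using schoenberg_wave_ternary_digit[of a] a by auto
  have "peano_curve t = x"
    using b(2) by (simp add: peano_curve_def vec_eq_iff digit(1) a_def sums_iff)
  then show ?thesis
    using digit(2,3) by auto
qed

text \<open>The least preimage is a section, attained because fibres are closed. Its sublevel sets
  are images of compact intervals, hence closed, and so it is Borel.\<close>

lemma borel_section_continuous_curve:
  fixes f :: "real \<Rightarrow> 'a::t2_space"
  assumes f: "continuous_on {a..b} f"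
  obtains g where "g \<in> borel_measurable borel" "\<And>x. x \<in> f ` {a..b} \<Longrightarrow> g x \<in> {a..b} \<and> f (g x) = x"
proof -
  \<comment> \<open>The default \<open>b\<close> keeps points outside the image out of every
    sublevel set with \<open>c < b\<close> and puts them into every one with
    \<open>b \<le> c\<close>.\<close>
  define g where "g x = (if x \<in> f ` {a..b} then Inf {t \<in> {a..b}. f t = x} else b)" for x
  have closed: "closed (f ` {a..c})" if "c \<le> b" for c
    by (intro compact_imp_closed compact_continuous_image continuous_on_subset[OF f])
       (use that in auto)
  have inf_mem: "Inf {t \<in> {a..b}. f t = x} \<in> {t \<in> {a..b}. f t = x}" if "x \<in> f ` {a..b}" for x
  proof (rule closed_contains_Inf)
    show "closed {t \<in> {a..b}. f t = x}"
      using continuous_closed_preimage_constant[OF f] by simp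
  qed (use that in \<open>auto intro: bdd_belowI[of _ a]\<close>)
  have g: "g x \<in> {a..b} \<and> f (g x) = x" if "x \<in> f ` {a..b}" for x
    using inf_mem[OF that] that by (simp add: g_def)
  have "g x \<le> c \<longleftrightarrow> x \<in> f ` {a..c}" if "c < b" for x c
  proof
    assume *: "g x \<le> c"
    with that have "x \<in> f ` {a..b}"
      by (auto simp: g_def split: if_splits)
    from g[OF this] * show "x \<in> f ` {a..c}"
      by (metis atLeastAtMost_iff imageI)
  next
    assume *: "x \<in> f ` {a..c}"
    then obtain t where t: "t \<in> {a..c}" "f t = x" by auto
    have "Inf {t \<in> {a..b}. f t = x} \<le> t"
      by (rule cInf_lower) (use t that in \<open>auto intro: bdd_belowI[of _ a]\<close>)
    moreover have "x \<in> f ` {a..b}"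
      using * that by auto
    ultimately show "g x \<le> c"
      using t by (simp add: g_def)
  qed
  then have low: "{x. g x \<le> c} = f ` {a..c}" if "c < b" for c
    using that by blast
  have "g x \<le> b" for x
    using g[of x] by (cases "x \<in> f ` {a..b}") (auto simp: g_def)
  then have high: "{x. g x \<le> c} = UNIV" if "b \<le> c" for c
    using that by (auto intro: order_trans)
  have "g \<in> borel_measurable borel"
  proof (rule borel_measurableI_le)
    fix c
    show "{x \<in> space borel. g x \<le> c} \<in> sets borel"
      by (cases "c < b") (auto simp: low high intro!: borel_closed closed)
  qed
  with g show ?thesis using that by blast
qed

subsection \<open>Limits of multivariate distribution functions\<close>

lemma borel_measurable_vec_lambda:
  fixes f :: "'n::finite \<Rightarrow> 'a \<Rightarrow> real"
  assumes "\<And>i. f i \<in> borel_measurable M"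
  shows "(\<lambda>x. \<chi> i. f i x) \<in> borel_measurable M"
proof (rule borel_measurable_euclidean_space[THEN iffD2], rule ballI)
  fix b :: "real ^ 'n"
  assume "b \<in> Basis"
  then obtain i where "b = axis i 1"
    by (auto simp: Basis_vec_def)
  then show "(\<lambda>x. (\<chi> i. f i x) \<bullet> b) \<in> borel_measurable M"
    using assms[of i] by (simp add: inner_axis)
qed

lemma borel_measurable_vec_nth [measurable]:
  "(\<lambda>x :: real ^ 'n::finite. x $ i) \<in> borel_measurable borel"
  by (intro borel_measurable_continuous_onI continuous_on_component continuous_on_id)

text \<open>The section \<open>g\<close> lifts the measures to [0, 1], where tightness is automatic
  and Helly's theorem applies; the curve pushes the limit back. Since the curve inverts
  \<open>g\<close> almost everywhere, integrals of \<open>h\<close> over the cube are integrals of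
  \<open>h\<close> composed with the curve over the line.\<close>

lemma convergent_subsequence_in_unit_cube:
  fixes \<mu> :: "nat \<Rightarrow> (real ^ 'n::finite) measure"
  assumes \<mu>: "\<And>n. prob_space (\<mu> n)" "\<And>n. sets (\<mu> n) = sets borel"
    and cube: "\<And>n. AE x in \<mu> n. \<forall>i. 0 < x $ i \<and> x $ i < 1"
  obtains r \<nu> where "strict_mono (r :: nat \<Rightarrow> nat)" "prob_space \<nu>" "sets \<nu> = sets borel"
    "\<forall>h :: real ^ 'n \<Rightarrow> real. continuous_on UNIV h \<longrightarrow> bounded (range h) \<longrightarrow>
       (\<lambda>n. \<integral>x. h x \<partial>\<mu> (r n)) \<longlonglongrightarrow> (\<integral>x. h x \<partial>\<nu>)"
proof -
  let ?f = "peano_curve :: real \<Rightarrow> real ^ 'n"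
  obtain g where g_borel: "g \<in> borel_measurable borel"
    and g: "\<And>x. x \<in> ?f ` {0..1} \<Longrightarrow> g x \<in> {0..1} \<and> ?f (g x) = x"
    using borel_section_continuous_curve[of 0 1 ?f, OF continuous_on_peano_curve] by metis
  have f_borel [measurable]: "?f \<in> borel_measurable borel"
    by (intro borel_measurable_continuous_onI continuous_on_peano_curve)
  have g_meas [measurable]: "g \<in> borel_measurable (\<mu> n)" for n
    using g_borel measurable_cong_sets[OF \<mu>(2) refl] by blast
  have sect: "AE x in \<mu> n. g x \<in> {0..1} \<and> ?f (g x) = x" for n
    using cube[of n] by eventually_elim (intro g peano_curve_covers; simp add: less_imp_le)
  define \<rho> where "\<rho> n = distr (\<mu> n) borel g" for n
  have \<rho>: "real_distribution (\<rho> n)" for n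
    unfolding \<rho>_def by (intro prob_space.real_distribution_distr \<mu>(1) g_meas)
  \<comment> \<open>Tightness is stated with intervals open on the left, so the left end lies below
    0 to retain a possible atom at 0.\<close>
  have "measure (\<rho> n) {-1<..1} = 1" for n
  proof -
    interpret real_distribution "\<rho> n" by (rule \<rho>)
    have "AE t in \<rho> n. t \<in> {-1<..1}"
      unfolding \<rho>_def using sect[of n] by (subst AE_distr_iff) auto
    then show ?thesis
      by (subst prob_eq_1) auto
  qed
  then have "tight \<rho>"
    unfolding tight_def using \<rho> by (intro conjI allI impI exI[of _ "-1"] exI[of _ 1]) auto
  from tight_imp_convergent_subsubsequence[OF this strict_mono_id]
  obtain r \<rho>' where r: "strict_mono r" and \<rho>': "real_distribution \<rho>'"
    and weak: "weak_conv_m (\<rho> \<circ> id \<circ> r) \<rho>'"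
    by blast
  interpret \<rho>': real_distribution \<rho>' by (rule \<rho>')
  define \<nu> where "\<nu> = distr \<rho>' borel ?f"
  show ?thesis
  proof (rule that[OF r])
    show "prob_space \<nu>"
      unfolding \<nu>_def by (intro \<rho>'.prob_space_distr) auto
    show "sets \<nu> = sets borel"
      by (simp add: \<nu>_def)
  next
    have "(\<lambda>n. \<integral>x. h x \<partial>\<mu> (r n)) \<longlonglongrightarrow> (\<integral>x. h x \<partial>\<nu>)"
      if h: "continuous_on UNIV h" "bounded (range h)" for h :: "real ^ 'n \<Rightarrow> real"
    proof -
      obtain B where B: "\<And>x. \<bar>h x\<bar> \<le> B"
        using h(2) by (auto simp: bounded_iff)
      have h_borel [measurable]: "h \<in> borel_measurable borel"
        using h(1) by (rule borel_measurable_continuous_onI)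
      have hf: "isCont (\<lambda>t. h (?f t)) t" for t
      proof -
        have "continuous_on UNIV (\<lambda>t. h (?f t))"
          by (rule continuous_on_compose2[OF h(1) continuous_on_peano_curve]) auto
        then show ?thesis by (simp add: continuous_on_eq_continuous_at)
      qed
      have "(\<lambda>n. \<integral>t. h (?f t) \<partial>(\<rho> \<circ> id \<circ> r) n) \<longlonglongrightarrow> (\<integral>t. h (?f t) \<partial>\<rho>')"
        by (rule weak_conv_imp_integral_bdd_continuous_conv[OF _ \<rho>' weak hf, where B = B])
           (use \<rho> B in auto)
      moreover have "(\<integral>t. h (?f t) \<partial>(\<rho> \<circ> id \<circ> r) n) = (\<integral>x. h x \<partial>\<mu> (r n))" for n
      proof -
        have "(\<integral>t. h (?f t) \<partial>(\<rho> \<circ> id \<circ> r) n) = (\<integral>x. h (?f (g x)) \<partial>\<mu> (r n))"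
          by (simp add: \<rho>_def integral_distr)
        also have "\<dots> = (\<integral>x. h x \<partial>\<mu> (r n))"
        proof (rule integral_cong_AE)
          show "AE x in \<mu> (r n). h (?f (g x)) = h x"
            using sect[of "r n"] by eventually_elim simp
          show "h \<in> borel_measurable (\<mu> (r n))"
            using h_borel measurable_cong_sets[OF \<mu>(2) refl] by blast
        qed simp
        finally show ?thesis .
      qed
      moreover have "(\<integral>x. h x \<partial>\<nu>) = (\<integral>t. h (?f t) \<partial>\<rho>')"
        by (simp add: \<nu>_def integral_distr)
      ultimately show ?thesis
        by simp
    qed
    then show "\<forall>h :: real ^ 'n \<Rightarrow> real. continuous_on UNIV h \<longrightarrow> bounded (range h) \<longrightarrow>
       (\<lambda>n. \<integral>x. h x \<partial>\<mu> (r n)) \<longlonglongrightarrow> (\<integral>x. h x \<partial>\<nu>)"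
      by blast
  qed
qed

text \<open>The product over the coordinates of piecewise linear ramps, falling from 1 at
  \<open>y $ i\<close> to 0 at \<open>y' $ i\<close>, lies between the two indicators.\<close>

lemma orthant_ramp_exists:
  fixes y y' :: "real ^ 'n::finite"
  assumes less: "\<And>i. y $ i < y' $ i"
  obtains h :: "real ^ 'n \<Rightarrow> real" where "continuous_on UNIV h" "\<And>z. \<bar>h z\<bar> \<le> 1"
    "\<And>z. indicator {..y} z \<le> h z" "\<And>z. h z \<le> indicator {..y'} z"
proof -
  define c where "c i z = min 1 (max 0 ((y' $ i - z $ i) / (y' $ i - y $ i)))"
    for i and z :: "real ^ 'n"
  define h where "h z = (\<Prod>i\<in>UNIV. c i z)" for z
  have c: "0 \<le> c i z" "c i z \<le> 1" for i z
    by (auto simp: c_def)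
  have h: "0 \<le> h z" "h z \<le> 1" for z
    unfolding h_def using c by (auto intro: prod_nonneg prod_le_1)
  show ?thesis
  proof
    show "continuous_on UNIV h"
      unfolding h_def c_def using less by (intro continuous_intros) (metis eq_iff_diff_eq_0 less_irrefl)
    show "\<bar>h z\<bar> \<le> 1" for z
      using h[of z] by simp
    show "indicator {..y} z \<le> h z" for z
    proof (cases "z \<le> y")
      case True
      have "c i z = 1" for i
        using True less[of i] by (simp add: c_def less_eq_vec_def le_max_iff_disj le_divide_eq)
      then show ?thesis by (simp add: h_def indicator_def)
    qed (use h in \<open>simp add: indicator_def\<close>)
    show "h z \<le> indicator {..y'} z" for z
    proof (cases "z \<le> y'")
      case False
      then obtain i where i: "y' $ i < z $ i"
        by (auto simp: less_eq_vec_def not_le)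
      have "c i z = 0"
        using i less[of i] by (auto simp: c_def max_def divide_simps)
      then have "h z = 0"
        unfolding h_def by (intro prod_zero) auto
      then show ?thesis by simp
    qed (use h in \<open>simp add: indicator_def\<close>)
  qed
qed

text \<open>A portmanteau estimate for orthants: integrals of a ramp between the indicators of
  \<open>{..y}\<close> and \<open>{..y'}\<close> converge, and the gap between the corners absorbs
  any mass on the boundary.\<close>

lemma orthant_sandwich:
  fixes \<mu> :: "nat \<Rightarrow> (real ^ 'n::finite) measure" and \<nu> :: "(real ^ 'n) measure"
  assumes \<mu>: "\<And>n. prob_space (\<mu> n)" "\<And>n. sets (\<mu> n) = sets borel"
    and \<nu>: "prob_space \<nu>" "sets \<nu> = sets borel"
    and conv: "\<forall>h :: real ^ 'n \<Rightarrow> real. continuous_on UNIV h \<longrightarrow> bounded (range h) \<longrightarrow>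
       (\<lambda>n. \<integral>x. h x \<partial>\<mu> n) \<longlonglongrightarrow> (\<integral>x. h x \<partial>\<nu>)"
    and less: "\<And>i. y $ i < y' $ i"
  shows "(\<lambda>n. measure (\<mu> n) {..y}) \<longlonglongrightarrow> \<kappa> \<Longrightarrow> \<kappa> \<le> measure \<nu> {..y'}"
    and "(\<lambda>n. measure (\<mu> n) {..y'}) \<longlonglongrightarrow> \<kappa> \<Longrightarrow> measure \<nu> {..y} \<le> \<kappa>"
proof -
  obtain h :: "real ^ 'n \<Rightarrow> real" where h: "continuous_on UNIV h" "\<And>z. \<bar>h z\<bar> \<le> 1"
    "\<And>z. indicator {..y} z \<le> h z" "\<And>z. h z \<le> indicator {..y'} z"
    using orthant_ramp_exists[OF less] by metis
  have bounds: "measure \<sigma> {..y} \<le> (\<integral>x. h x \<partial>\<sigma>)" "(\<integral>x. h x \<partial>\<sigma>) \<le> measure \<sigma> {..y'}"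
    if \<sigma>: "prob_space \<sigma>" "sets \<sigma> = sets borel" for \<sigma> :: "(real ^ 'n) measure"
  proof -
    interpret prob_space \<sigma> by (rule \<sigma>(1))
    have "h \<in> borel_measurable \<sigma>"
      using borel_measurable_continuous_onI[OF h(1)] measurable_cong_sets[OF \<sigma>(2) refl] by blast
    then have int_h: "integrable \<sigma> h"
      using h(2) by (intro integrable_const_bound[of _ 1]) auto
    have int_ind: "integrable \<sigma> (indicator {..z} :: _ \<Rightarrow> real)" for z :: "real ^ 'n"
      using \<sigma>(2) by (intro integrable_const_bound[of _ 1]) (auto simp: indicator_def)
    have meas: "measure \<sigma> {..z} = (\<integral>x. indicator {..z} x \<partial>\<sigma>)" for z :: "real ^ 'n"
      using \<sigma>(2) sets_eq_imp_space_eq[OF \<sigma>(2)] by simp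
    show "measure \<sigma> {..y} \<le> (\<integral>x. h x \<partial>\<sigma>)" "(\<integral>x. h x \<partial>\<sigma>) \<le> measure \<sigma> {..y'}"
      unfolding meas by (intro integral_mono int_h int_ind h)+
  qed
  have "bounded (range h)"
    using h(2) by (auto simp: bounded_iff)
  with conv h(1) have lim: "(\<lambda>n. \<integral>x. h x \<partial>\<mu> n) \<longlonglongrightarrow> (\<integral>x. h x \<partial>\<nu>)"
    by blast
  show "\<kappa> \<le> measure \<nu> {..y'}" if "(\<lambda>n. measure (\<mu> n) {..y}) \<longlonglongrightarrow> \<kappa>"
  proof -
    have "\<kappa> \<le> (\<integral>x. h x \<partial>\<nu>)"
      by (rule LIMSEQ_le[OF that lim]) (use bounds(1)[OF \<mu>] in auto)
    also have "\<dots> \<le> measure \<nu> {..y'}"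
      by (rule bounds(2)[OF \<nu>])
    finally show ?thesis .
  qed
  show "measure \<nu> {..y} \<le> \<kappa>" if "(\<lambda>n. measure (\<mu> n) {..y'}) \<longlonglongrightarrow> \<kappa>"
  proof -
    have "measure \<nu> {..y} \<le> (\<integral>x. h x \<partial>\<nu>)"
      by (rule bounds(1)[OF \<nu>])
    also have "\<dots> \<le> \<kappa>"
      by (rule LIMSEQ_le[OF lim that]) (use bounds(2)[OF \<mu>] in auto)
    finally show ?thesis .
  qed
qed

section \<open>Order isomorphism of R^d with the open unit cube\<close>

definition squash :: "real ^ 'n::finite \<Rightarrow> real ^ 'n" where
  "squash x = (\<chi> i. arctan (x $ i) / pi + 1 / 2)"

text \<open>Inverse of \<open>squash\<close> on the open cube. Elsewhere its values carry no
  meaning; only measurability on the whole space matters there.\<close>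

definition unsquash :: "real ^ 'n::finite \<Rightarrow> real ^ 'n" where
  "unsquash y = (\<chi> i. tan (pi * (y $ i - 1 / 2)))"

lemma squash_bounds: "0 < squash x $ i" "squash x $ i < 1"
  using arctan_bounded[of "x $ i"] by (auto simp: squash_def field_simps)

lemma squash_le_iff: "squash x $ i \<le> squash y $ i \<longleftrightarrow> x $ i \<le> y $ i"
  by (simp add: squash_def divide_le_cancel arctan_le_iff)

lemma squash_mono_iff: "squash x \<le> squash y \<longleftrightarrow> x \<le> y"
  by (simp add: less_eq_vec_def squash_le_iff)

lemma squash_unsquash:
  assumes "0 < y $ i" "y $ i < 1"
  shows "squash (unsquash y) $ i = y $ i"
proof -
  have "arctan (tan (pi * (y $ i - 1 / 2))) = pi * (y $ i - 1 / 2)"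
    using assms mult_strict_left_mono[of "- 1 / 2" "y $ i - 1 / 2" pi]
      mult_strict_left_mono[of "y $ i - 1 / 2" "1 / 2" pi]
    by (intro arctan_tan) auto
  then show ?thesis
    by (simp add: squash_def unsquash_def)
qed

lemma borel_measurable_squash [measurable]: "squash \<in> borel_measurable borel"
  unfolding squash_def
  by (intro borel_measurable_vec_lambda borel_measurable_continuous_onI continuous_intros) auto

lemma borel_measurable_unsquash [measurable]: "unsquash \<in> borel_measurable borel"
  \<comment> \<open>As a quotient of sine and cosine with total division, the tangent is Borel
    measurable across its poles.\<close>
  unfolding unsquash_def tan_def by (intro borel_measurable_vec_lambda) measurable

text \<open>After squashing into the cube a weak limit \<open>\<nu>\<close> exists along a
  subsequence. Right continuity of \<open>K\<close> identifies its orthant masses with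
  \<open>K\<close>, although convergence is known only at suitable diagonal shifts. The limits
  \<open>top\<close> and \<open>bot\<close> forbid mass on the faces of the cube, so
  \<open>\<nu>\<close> can be carried back to R^d.\<close>

lemma is_joint_cdf_limit:
  fixes F :: "nat \<Rightarrow> real ^ 'n::finite \<Rightarrow> real"
  assumes F: "\<And>n. is_joint_cdf (F n)"
    and dense: "\<And>x e. 0 < e \<Longrightarrow> \<exists>t>0. t < e \<and> (\<lambda>n. F n (x + vec t)) \<longlonglongrightarrow> K (x + vec t)"
    and right_cont: "\<And>x. ((\<lambda>t. K (x + vec t)) \<longlongrightarrow> K x) (at_right 0)"
    and top: "((\<lambda>t. K (vec t)) \<longlongrightarrow> 1) at_top"
    and bot: "\<And>x i. ((\<lambda>t. K (\<chi> l. if l = i then t else x $ l)) \<longlongrightarrow> 0) at_bot"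
  shows "is_joint_cdf K"
proof -
  obtain \<mu> where \<mu>: "\<And>n. prob_space (\<mu> n)" "\<And>n. sets (\<mu> n) = sets borel"
    "\<And>n. F n = joint_cdf (\<mu> n)"
    using F unfolding is_joint_cdf_def by metis
  have squash_meas [measurable]: "squash \<in> borel_measurable (\<mu> n)" for n
    using borel_measurable_squash measurable_cong_sets[OF \<mu>(2) refl] by blast
  have space_\<mu>: "space (\<mu> n) = UNIV" for n
    using sets_eq_imp_space_eq[OF \<mu>(2)] by simp
  define \<mu>' where "\<mu>' n = distr (\<mu> n) borel squash" for n
  have \<mu>': "prob_space (\<mu>' n)" "sets (\<mu>' n) = sets borel" for n
    unfolding \<mu>'_def by (auto intro!: prob_space.prob_space_distr \<mu>(1))
  have meas_\<mu>': "measure (\<mu>' n) {..squash x} = F n x" for n x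
    by (simp add: \<mu>'_def \<mu>(3) joint_cdf_def measure_distr space_\<mu> vimage_def squash_mono_iff
        atMost_def)
  have cube': "AE y in \<mu>' n. \<forall>i. 0 < y $ i \<and> y $ i < 1" for n
    unfolding \<mu>'_def by (subst AE_distr_iff) (auto simp: squash_bounds)
  obtain r \<nu> where r: "strict_mono r" and \<nu>: "prob_space \<nu>" "sets \<nu> = sets borel"
    and conv: "\<forall>h :: real ^ 'n \<Rightarrow> real. continuous_on UNIV h \<longrightarrow> bounded (range h) \<longrightarrow>
       (\<lambda>n. \<integral>x. h x \<partial>\<mu>' (r n)) \<longlonglongrightarrow> (\<integral>x. h x \<partial>\<nu>)"
    using convergent_subsequence_in_unit_cube[of \<mu>', OF \<mu>' cube'] by blast
  interpret \<nu>: prob_space \<nu> by (rule \<nu>(1))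
  have space_\<nu>: "space \<nu> = UNIV"
    using sets_eq_imp_space_eq[OF \<nu>(2)] by simp
  note [measurable_cong] = \<nu>(2)
  have sub: "(\<lambda>n. measure (\<mu>' (r n)) {..squash x}) \<longlonglongrightarrow> K x"
    if "(\<lambda>n. F n x) \<longlonglongrightarrow> K x" for x
    using LIMSEQ_subseq_LIMSEQ[OF that r] by (simp add: meas_\<mu>' o_def)
  have shift_less: "squash (x + vec s) $ i < squash (x + vec t) $ i" if "s < t" for x :: "real ^ 'n" and i s t
    using squash_le_iff[of "x + vec t" i "x + vec s"] that by (simp add: not_le[symmetric])
  note sandwich = orthant_sandwich[of "\<lambda>n. \<mu>' (r n)", OF \<mu>' \<nu> conv]
  \<comment> \<open>The corner is approached along shifts \<open>x + vec t\<close> with small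
    \<open>t > 0\<close>. Right continuity of \<open>K\<close> gives the first inequality; the
    second also uses continuity of \<open>\<nu>\<close> from above.\<close>
  have K_eq: "measure \<nu> {..squash x} = K x" for x
  proof (rule antisym)
    show "measure \<nu> {..squash x} \<le> K x"
    proof (rule field_le_epsilon)
      fix e :: real assume "0 < e"
      with right_cont[of x] have "\<forall>\<^sub>F t in at_right 0. K (x + vec t) < K x + e"
        by (intro order_tendstoD) auto
      then obtain b where b: "0 < b" "\<And>t. 0 < t \<Longrightarrow> t < b \<Longrightarrow> K (x + vec t) < K x + e"
        unfolding eventually_at_right[OF zero_less_one] by auto
      obtain t where t: "0 < t" "t < b" "(\<lambda>n. F n (x + vec t)) \<longlonglongrightarrow> K (x + vec t)"
        using dense[OF b(1)] by blast
      have "measure \<nu> {..squash x} \<le> K (x + vec t)"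
        by (rule sandwich(2)[OF _ sub[OF t(3)]]) (use shift_less[of 0 t x] t(1) in auto)
      with b(2)[OF t(1,2)] show "measure \<nu> {..squash x} \<le> K x + e" by simp
    qed
    show "K x \<le> measure \<nu> {..squash x}"
    proof (rule field_le_epsilon)
      fix e :: real assume e: "0 < e"
      with right_cont[of x] have "\<forall>\<^sub>F t in at_right 0. K x - e / 2 < K (x + vec t)"
        by (intro order_tendstoD) auto
      then obtain b where b: "0 < b" "\<And>t. 0 < t \<Longrightarrow> t < b \<Longrightarrow> K x - e / 2 < K (x + vec t)"
        unfolding eventually_at_right[OF zero_less_one] by auto
      \<comment> \<open>The shifts \<open>S m\<close> decrease to 0 and never exceed
        \<open>b\<close>, so any \<open>t < S m\<close> supplied by \<open>dense\<close> is still in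
        the range where \<open>K\<close> is controlled.\<close>
      define S where "S m = b / real (Suc m)" for m
      have S: "0 < S m" "S m \<le> b" for m
        using b(1) by (auto simp: S_def divide_simps)
      have S_lim: "S \<longlonglongrightarrow> 0"
        unfolding S_def using LIMSEQ_Suc[OF lim_const_over_n[of b]] by simp
      have "decseq S"
        unfolding S_def decseq_def using b(1) by (auto intro!: divide_left_mono)
      then have dec: "decseq (\<lambda>m. {..squash (x + vec (S m))})"
        unfolding decseq_def by (auto elim!: order_trans simp: squash_le_iff less_eq_vec_def)
      have INT: "(\<Inter>m. {..squash (x + vec (S m))}) = {..squash x}"
      proof (intro equalityI subsetI)
        fix y assume y: "y \<in> (\<Inter>m. {..squash (x + vec (S m))})"
        have "y $ i \<le> squash x $ i" for i
        proof (rule LIMSEQ_le_const)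
          show "(\<lambda>m. squash (x + vec (S m)) $ i) \<longlonglongrightarrow> squash x $ i"
            unfolding squash_def using S_lim by (auto intro!: tendsto_eq_intros)
          show "\<exists>N. \<forall>n\<ge>N. y $ i \<le> squash (x + vec (S n)) $ i"
            using y by (auto simp: less_eq_vec_def)
        qed
        then show "y \<in> {..squash x}" by (simp add: less_eq_vec_def)
      next
        fix y assume "y \<in> {..squash x}"
        moreover have "squash x \<le> squash (x + vec (S m))" for m
          using S(1)[of m] by (simp add: squash_le_iff less_eq_vec_def)
        ultimately show "y \<in> (\<Inter>m. {..squash (x + vec (S m))})"
          by (auto intro: order_trans)
      qed
      have "(\<lambda>m. measure \<nu> {..squash (x + vec (S m))}) \<longlonglongrightarrow> measure \<nu> {..squash x}"
        using \<nu>.finite_Lim_measure_decseq[OF _ dec] unfolding INT by (simp add: \<nu>(2) image_subset_iff)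
      then have "\<forall>\<^sub>F m in sequentially.
          measure \<nu> {..squash (x + vec (S m))} < measure \<nu> {..squash x} + e / 2"
        using e by (intro order_tendstoD) auto
      then obtain m where m: "measure \<nu> {..squash (x + vec (S m))} < measure \<nu> {..squash x} + e / 2"
        by (auto simp: eventually_sequentially)
      obtain t where t: "0 < t" "t < S m" "(\<lambda>n. F n (x + vec t)) \<longlonglongrightarrow> K (x + vec t)"
        using dense[OF S(1)] by blast
      have "K x - e / 2 < K (x + vec t)"
        using b(2)[of t] t S(2)[of m] by simp
      also have "K (x + vec t) \<le> measure \<nu> {..squash (x + vec (S m))}"
        by (rule sandwich(1)[OF _ sub[OF t(3)]]) (use shift_less[OF t(2)] in auto)
      finally show "K x \<le> measure \<nu> {..squash x} + e"
        using m by simp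
    qed
  qed
  \<comment> \<open>No mass lies on the upper faces: the orthants with corners
    \<open>squash (vec m)\<close>, all of whose coordinates are below 1, have masses tending to
    1.\<close>
  have below: "AE y in \<nu>. \<exists>m::nat. y \<le> squash (vec (real m))"
  proof -
    have "(\<lambda>m. measure \<nu> {..squash (vec (real m) :: real ^ 'n)}) \<longlonglongrightarrow> 1"
      unfolding K_eq using filterlim_compose[OF top filterlim_real_sequentially] .
    moreover have "(\<lambda>m. measure \<nu> {..squash (vec (real m) :: real ^ 'n)})
        \<longlonglongrightarrow> measure \<nu> (\<Union>m. {..squash (vec (real m))})"
      by (rule \<nu>.finite_Lim_measure_incseq)
         (auto simp: \<nu>(2) incseq_def squash_le_iff less_eq_vec_def elim!: order_trans)
    ultimately have "measure \<nu> (\<Union>m. {..squash (vec (real m) :: real ^ 'n)}) = 1"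
      using LIMSEQ_unique by blast
    then have "AE y in \<nu>. y \<in> (\<Union>m. {..squash (vec (real m))})"
      by (subst (asm) \<nu>.prob_eq_1) (auto simp: \<nu>(2))
    then show ?thesis by eventually_elim auto
  qed
  \<comment> \<open>No mass lies on the lower faces: as \<open>squash\<close> is positive, the
    exceptional set is contained in the orthant whose corner has \<open>i\<close>-th coordinate
    \<open>squash\<close> of \<open>t\<close>, for every \<open>t\<close>. The mass of that orthant
    tends to 0 as \<open>t\<close> tends to minus infinity.\<close>
  have "AE y in \<nu>. \<not> (y $ i \<le> 0 \<and> y \<le> squash (vec (real m)))" for i and m :: nat
  proof -
    let ?E = "{y. y $ i \<le> 0 \<and> y \<le> squash (vec (real m))} :: (real ^ 'n) set"
    have E: "?E = {y \<in> space borel. y $ i \<le> 0} \<inter> {..squash (vec (real m))}"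
      by auto
    have E_sets: "?E \<in> sets \<nu>"
      unfolding E \<nu>(2) by measurable
    have le: "measure \<nu> ?E \<le> K (\<chi> l. if l = i then t else vec (real m) $ l)" for t
      unfolding K_eq[symmetric]
    proof (rule \<nu>.finite_measure_mono)
      show "?E \<subseteq> {..squash (\<chi> l. if l = i then t else vec (real m) $ l)}"
      proof
        fix y assume y: "y \<in> ?E"
        have "y $ l \<le> squash (\<chi> l. if l = i then t else vec (real m) $ l) $ l" for l
        proof (cases "l = i")
          case True
          then show ?thesis
            using y squash_bounds(1)[of "\<chi> l. if l = i then t else vec (real m) $ l" i]
            by (auto intro: order_trans less_imp_le)
        next
          case False
          then show ?thesis
            using y by (auto simp: less_eq_vec_def squash_def)
        qed
        then show "y \<in> {..squash (\<chi> l. if l = i then t else vec (real m) $ l)}"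
          by (simp add: less_eq_vec_def)
      qed
    qed (simp add: \<nu>(2))
    have "measure \<nu> ?E \<le> 0"
      by (rule tendsto_le[OF _ bot[of i "vec (real m)"] tendsto_const]) (use le in auto)
    then have "measure \<nu> ?E = 0"
      using measure_nonneg[of \<nu> ?E] by linarith
    then have "?E \<in> null_sets \<nu>"
      using E_sets by (simp add: null_sets_def \<nu>.emeasure_eq_measure)
    then show ?thesis
      by (rule AE_I'[where N = ?E]) auto
  qed
  then have "AE y in \<nu>. \<forall>i m. \<not> (y $ i \<le> 0 \<and> y \<le> squash (vec (real m)))"
    unfolding AE_all_countable by blast
  with below have cube: "AE y in \<nu>. \<forall>i. 0 < y $ i \<and> y $ i < 1"
  proof eventually_elim
    case (elim y)
    then obtain m :: nat where m: "y \<le> squash (vec (real m))" by blast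
    show ?case
    proof
      fix i
      have "y $ i \<le> squash (vec (real m)) $ i"
        using m by (simp add: less_eq_vec_def)
      then have "y $ i < 1"
        using squash_bounds(2)[of "vec (real m)" i] by linarith
      then show "0 < y $ i \<and> y $ i < 1"
        using elim(2) m by (auto simp: not_le)
    qed
  qed
  define \<tau> where "\<tau> = distr \<nu> borel unsquash"
  have "joint_cdf \<tau> x = K x" for x
  proof -
    have "joint_cdf \<tau> x = measure \<nu> {y. unsquash y \<le> x}"
      by (simp add: \<tau>_def joint_cdf_def measure_distr space_\<nu> vimage_def)
    also have "\<dots> = measure \<nu> {..squash x}"
    proof (rule \<nu>.finite_measure_eq_AE)
      show "AE y in \<nu>. (y \<in> {y. unsquash y \<le> x}) = (y \<in> {..squash x})"
        using cube
      proof eventually_elim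
        case (elim y)
        then have "squash (unsquash y) = y"
          by (simp add: vec_eq_iff squash_unsquash)
        then show ?case
          using squash_mono_iff[of "unsquash y" x] by simp
      qed
      have "{y \<in> space borel. unsquash y \<in> {..x}} \<in> sets borel"
        by measurable
      then show "{y. unsquash y \<le> x} \<in> sets \<nu>"
        by (simp add: \<nu>(2))
    qed (simp add: \<nu>(2))
    finally show ?thesis
      by (simp add: K_eq)
  qed
  moreover have "prob_space \<tau>" "sets \<tau> = sets borel"
    unfolding \<tau>_def by (auto intro!: \<nu>.prob_space_distr)
  ultimately show ?thesis
    unfolding is_joint_cdf_def by (metis ext)
qed

section \<open>Monotonicity, one-sided continuity and boundary limits of a distribution
  function\<close>

context
  fixes L :: "(real ^ 'n::finite) measure"
  assumes L: "prob_space L" "sets L = sets borel"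
begin

interpretation prob_space L by (rule L(1))

lemma joint_cdf_bounds: "0 \<le> joint_cdf L x" "joint_cdf L x \<le> 1"
  by (auto simp: joint_cdf_def)

lemma joint_cdf_mono: "x \<le> y \<Longrightarrow> joint_cdf L x \<le> joint_cdf L y"
  unfolding joint_cdf_def by (intro finite_measure_mono) (auto simp: L(2) intro: order_trans)

lemma joint_cdf_right_continuous:
  "((\<lambda>t. joint_cdf L (x + vec t)) \<longlongrightarrow> joint_cdf L x) (at_right 0)"
proof (rule tendsto_at_right_sequentially[of 0 1])
  fix S :: "nat \<Rightarrow> real"
  assume S: "\<And>n. 0 < S n" "decseq S" "S \<longlonglongrightarrow> 0"
  have INT: "(\<Inter>m. {..x + vec (S m)}) = {..x}"
  proof (intro equalityI subsetI)
    fix y assume y: "y \<in> (\<Inter>m. {..x + vec (S m)})"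
    have "y $ i \<le> x $ i" for i
    proof (rule LIMSEQ_le_const)
      show "(\<lambda>m. x $ i + S m) \<longlonglongrightarrow> x $ i"
        using tendsto_add[OF tendsto_const S(3)] by simp
      show "\<exists>N. \<forall>n\<ge>N. y $ i \<le> x $ i + S n"
        using y by (auto simp: less_eq_vec_def)
    qed
    then show "y \<in> {..x}" by (simp add: less_eq_vec_def)
  next
    fix y assume "y \<in> {..x}"
    then show "y \<in> (\<Inter>m. {..x + vec (S m)})"
      using less_imp_le[OF S(1)] by (auto simp: less_eq_vec_def intro!: add_increasing2)
  qed
  have "decseq (\<lambda>m. {..x + vec (S m)})"
    using S(2) unfolding decseq_def by (auto elim!: order_trans simp: less_eq_vec_def)
  from finite_Lim_measure_decseq[OF _ this]
  show "(\<lambda>n. joint_cdf L (x + vec (S n))) \<longlonglongrightarrow> joint_cdf L x"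
    unfolding INT joint_cdf_def by (simp add: L(2) image_subset_iff)
qed simp

lemma joint_cdf_at_top: "((\<lambda>t. joint_cdf L (vec t)) \<longlongrightarrow> 1) at_top"
proof (rule tendsto_at_topI_sequentially_real)
  show "mono (\<lambda>t. joint_cdf L (vec t))"
    by (intro monoI joint_cdf_mono) (simp add: less_eq_vec_def)
  have UN: "(\<Union>m. {..vec (real m)}) = space L"
  proof -
    have "\<exists>m::nat. y \<le> vec (real m)" for y :: "real ^ 'n"
    proof -
      obtain m :: nat where "norm y \<le> real m"
        using real_arch_simple by blast
      then have "y $ i \<le> real m" for i
        using component_le_norm_cart[of y i] by linarith
      then show ?thesis by (auto simp: less_eq_vec_def)
    qed
    then show ?thesis
      using sets_eq_imp_space_eq[OF L(2)] by auto
  qed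
  have "incseq (\<lambda>m. {..vec (real m) :: real ^ 'n})"
    unfolding incseq_def by (auto elim!: order_trans simp: less_eq_vec_def)
  from finite_Lim_measure_incseq[OF _ this]
  show "(\<lambda>m. joint_cdf L (vec (real m))) \<longlonglongrightarrow> 1"
    unfolding UN joint_cdf_def by (simp add: L(2) image_subset_iff prob_space)
qed

lemma joint_cdf_at_bot: "((\<lambda>t. joint_cdf L (\<chi> l. if l = i then t else x $ l)) \<longlongrightarrow> 0) at_bot"
proof -
  \<comment> \<open>Two sign changes, in the argument and in the value, turn the limit at minus
    infinity into that of an increasing function at plus infinity, which may be checked along the
    integers.\<close>
  let ?x = "\<lambda>t. (\<chi> l. if l = i then - t else x $ l) :: real ^ 'n"
  have "((\<lambda>t. - joint_cdf L (?x t)) \<longlongrightarrow> 0) at_top"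
  proof (rule tendsto_at_topI_sequentially_real)
    show "mono (\<lambda>t. - joint_cdf L (?x t))"
      by (intro monoI le_imp_neg_le joint_cdf_mono) (simp add: less_eq_vec_def)
    have INT: "(\<Inter>m. {..?x (real m)}) = {}"
    proof -
      have False if "\<And>m::nat. y \<le> ?x (real m)" for y
      proof -
        obtain m :: nat where "- (y $ i) < real m"
          using reals_Archimedean2 by blast
        moreover have "y $ i \<le> - real m"
          using that[of m] by (auto simp: less_eq_vec_def dest: spec[of _ i])
        ultimately show False by simp
      qed
      then show ?thesis by blast
    qed
    have "decseq (\<lambda>m. {..?x (real m)})"
      unfolding decseq_def by (auto elim!: order_trans simp: less_eq_vec_def)
    from finite_Lim_measure_decseq[OF _ this]
    have "(\<lambda>m. joint_cdf L (?x (real m))) \<longlonglongrightarrow> 0"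
      unfolding INT joint_cdf_def by (simp add: L(2) image_subset_iff)
    from tendsto_minus[OF this] show "(\<lambda>m. - joint_cdf L (?x (real m))) \<longlonglongrightarrow> 0"
      by simp
  qed
  from tendsto_minus[OF this] show ?thesis
    by (simp add: filterlim_at_bot_mirror)
qed

text \<open>Along the diagonal through \<open>x\<close> the function is monotone, hence
  discontinuous at only countably many \<open>t\<close>. Diagonal continuity implies joint
  continuity, since points near \<open>x + vec t\<close> lie between two nearby diagonal points in
  the componentwise order.\<close>

lemma joint_cdf_continuity_point_near:
  assumes "0 < e"
  shows "\<exists>t>0. t < e \<and> isCont (joint_cdf L) (x + vec t)"
proof -
  let ?g = "\<lambda>t. joint_cdf L (x + vec t)"
  have "mono ?g"
    by (intro monoI joint_cdf_mono) (simp add: less_eq_vec_def)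
  then have "countable {t. \<not> isCont ?g t}"
    by (rule mono_ctble_discont)
  from open_minus_countable[OF this, of "{0<..<e}"] assms
  obtain t where t: "0 < t" "t < e" "isCont ?g t"
    by auto
  have "isCont (joint_cdf L) (x + vec t)"
    unfolding continuous_at_eps_delta
  proof (intro allI impI)
    fix \<epsilon> :: real assume "0 < \<epsilon>"
    then obtain d where d: "0 < d" "\<And>s. \<bar>s - t\<bar> < d \<Longrightarrow> \<bar>?g s - ?g t\<bar> < \<epsilon>"
      using t(3) unfolding continuous_at_eps_delta dist_real_def by blast
    show "\<exists>d>0. \<forall>y. dist y (x + vec t) < d
        \<longrightarrow> dist (joint_cdf L y) (joint_cdf L (x + vec t)) < \<epsilon>"
    \<comment> \<open>Radius \<open>d / 2\<close> keeps the bracketing diagonal points, at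
      parameters \<open>t - d / 2\<close> and \<open>t + d / 2\<close>, strictly within
      \<open>d\<close> of \<open>t\<close>.\<close>
    proof (intro exI[of _ "d / 2"] conjI allI impI)
      fix y assume "dist y (x + vec t) < d / 2"
      then have "\<bar>(y - (x + vec t)) $ i\<bar> < d / 2" for i
        using component_le_norm_cart[of "y - (x + vec t)" i] by (simp add: dist_norm)
      then have near: "\<bar>y $ i - (x $ i + t)\<bar> < d / 2" for i
        by simp
      have "x + vec (t - d / 2) \<le> y" "y \<le> x + vec (t + d / 2)"
        unfolding less_eq_vec_def
        using near by (simp_all add: abs_less_iff) (smt (verit) near)+
      then have "?g (t - d / 2) \<le> joint_cdf L y" "joint_cdf L y \<le> ?g (t + d / 2)"
        by (auto intro: joint_cdf_mono)
      moreover have "\<bar>?g (t - d / 2) - ?g t\<bar> < \<epsilon>" "\<bar>?g (t + d / 2) - ?g t\<bar> < \<epsilon>"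
        using d(1) by (auto intro: d(2))
      ultimately show "dist (joint_cdf L y) (joint_cdf L (x + vec t)) < \<epsilon>"
        unfolding dist_real_def by linarith
    qed (use d in simp)
  qed
  with t show ?thesis by blast
qed

end

text \<open>Composition with \<open>w\<close> preserves right continuity and the boundary limits,
  but in general not the non-negativity of rectangle masses; that comes from the approximating
  \<open>F n\<close>. Continuity points close to \<open>x\<close> on the diagonal provide the
  convergence.\<close>

lemma is_joint_cdf_transform_limit:
  fixes F :: "nat \<Rightarrow> real ^ 'n::finite \<Rightarrow> real"
  assumes F: "\<And>n. is_joint_cdf (F n)"
    and L: "prob_space L" "sets L = sets borel"
    and w: "continuous_on {0..1} w" "w 0 = 0" "w 1 = 1"
    and lim: "\<And>x. isCont (joint_cdf L) x \<Longrightarrow> (\<lambda>n. F n x) \<longlonglongrightarrow> w (joint_cdf L x)"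
  shows "is_joint_cdf (\<lambda>x. w (joint_cdf L x))"
proof (rule is_joint_cdf_limit[OF F])
  have w_lim: "((\<lambda>t. w (f t)) \<longlongrightarrow> w l) A"
    if "(f \<longlongrightarrow> l) A" "l \<in> {0..1}" "\<And>t. f t \<in> {0..1}" for f :: "real \<Rightarrow> real" and l A
    by (rule continuous_on_tendsto_compose[OF w(1) that(1,2)]) (use that(3) in auto)
  have mem: "joint_cdf L x \<in> {0..1}" for x
    using joint_cdf_bounds[OF L] by simp
  show "\<exists>t>0. t < e \<and> (\<lambda>n. F n (x + vec t)) \<longlonglongrightarrow> w (joint_cdf L (x + vec t))"
    if "0 < e" for x e
    using joint_cdf_continuity_point_near[OF L that] lim by blast
  show "((\<lambda>t. w (joint_cdf L (x + vec t))) \<longlongrightarrow> w (joint_cdf L x)) (at_right 0)" for x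
    by (intro w_lim joint_cdf_right_continuous L mem)
  show "((\<lambda>t. w (joint_cdf L (vec t))) \<longlongrightarrow> 1) at_top"
    using w_lim[OF joint_cdf_at_top[OF L]] mem w(3) by simp
  show "((\<lambda>t. w (joint_cdf L (\<chi> l. if l = i then t else x $ l))) \<longlongrightarrow> 0) at_bot" for x i
    using w_lim[OF joint_cdf_at_bot[OF L]] mem w(2) by simp
qed

subsection \<open>The Laplace transform as a homeomorphism of the unit interval\<close>

text \<open>Dominated convergence with bound 1. Positivity of \<open>Z\<close> gives continuity of
  the integrand at \<open>u = 0\<close> as well.\<close>

lemma continuous_on_integral_powr:
  fixes Z :: "'r \<Rightarrow> real"
  assumes R: "prob_space R" and [measurable]: "Z \<in> borel_measurable R" and pos: "AE \<omega> in R. 0 < Z \<omega>"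
  shows "continuous_on {0..1} (\<lambda>u. \<integral>\<omega>. u powr Z \<omega> \<partial>R)"
  unfolding continuous_on_sequentially o_def
proof (intro allI ballI impI, elim conjE)
  interpret prob_space R by (rule R)
  fix u and a :: real
  assume u: "\<forall>n. u n \<in> {0..1}" "u \<longlonglongrightarrow> a"
  show "(\<lambda>n. \<integral>\<omega>. u n powr Z \<omega> \<partial>R) \<longlonglongrightarrow> (\<integral>\<omega>. a powr Z \<omega> \<partial>R)"
  proof (rule integral_dominated_convergence[where w = "\<lambda>_. 1"])
    show "AE \<omega> in R. (\<lambda>n. u n powr Z \<omega>) \<longlonglongrightarrow> a powr Z \<omega>"
      using pos
    proof eventually_elim
      case (elim \<omega>)
      then show ?case
        using u by (intro tendsto_powr') auto
    qed
    show "AE \<omega> in R. norm (u n powr Z \<omega>) \<le> 1" for n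
      using pos
    proof eventually_elim
      case (elim \<omega>)
      then show ?case
        using u(1) powr_mono2[of "Z \<omega>" "u n" 1] by auto
    qed
  qed auto
qed

lemma strict_mono_on_integral_powr:
  fixes Z :: "'r \<Rightarrow> real"
  assumes R: "prob_space R" and [measurable]: "Z \<in> borel_measurable R" and pos: "AE \<omega> in R. 0 < Z \<omega>"
  shows "strict_mono_on {0..1} (\<lambda>u. \<integral>\<omega>. u powr Z \<omega> \<partial>R)"
proof (rule strict_mono_onI)
  interpret prob_space R by (rule R)
  fix u v :: real assume uv: "u \<in> {0..1}" "v \<in> {0..1}" "u < v"
  have int: "integrable R (\<lambda>\<omega>. a powr Z \<omega>)" if "a \<in> {0..1}" for a
  proof (rule integrable_const_bound[of _ 1])
    show "AE \<omega> in R. norm (a powr Z \<omega>) \<le> 1"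
      using pos
    proof eventually_elim
      case (elim \<omega>)
      then show ?case
        using that powr_mono2[of "Z \<omega>" a 1] by auto
    qed
  qed auto
  show "(\<integral>\<omega>. u powr Z \<omega> \<partial>R) < (\<integral>\<omega>. v powr Z \<omega> \<partial>R)"
  proof (rule integral_less_AE_space[OF int[OF uv(1)] int[OF uv(2)]])
    show "AE \<omega> in R. u powr Z \<omega> < v powr Z \<omega>"
      using pos
    proof eventually_elim
      case (elim \<omega>)
      then show ?case
        using uv by (intro powr_less_mono2) auto
    qed
  qed (simp add: emeasure_space_1)
qed

text \<open>The substitution u = e^(-v) moves the half-line to (0, 1], so that adjoining
  \<open>u = 0\<close> accounts for v = \<infinity>.\<close>

lemma laplace_transform_eq_integral_powr:
  "laplace_transform R Z v = (\<integral>\<omega>. exp (- v) powr Z \<omega> \<partial>R)"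
  by (simp add: laplace_transform_def powr_def mult.commute)

text \<open>Surjectivity is the intermediate value theorem; the inverse is continuous because the
  domain is compact.\<close>

lemma unit_interval_homeomorphism_inverse:
  fixes \<psi> :: "real \<Rightarrow> real"
  assumes cont: "continuous_on {0..1} \<psi>" and mono: "strict_mono_on {0..1} \<psi>"
    and "\<psi> 0 = 0" "\<psi> 1 = 1"
  obtains w where "continuous_on {0..1} w" "\<And>u. u \<in> {0..1} \<Longrightarrow> w (\<psi> u) = u"
    "\<And>u. u \<in> {0..1} \<Longrightarrow> \<psi> (w u) = u" "\<And>u. u \<in> {0..1} \<Longrightarrow> w u \<in> {0..1}"
    "\<And>u. u \<in> {0..1} \<Longrightarrow> \<psi> u \<in> {0..1}"
proof -
  define w where "w = the_inv_into {0..1} \<psi>"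
  have inj: "inj_on \<psi> {0..1}"
    using mono by (rule strict_mono_on_imp_inj_on)
  have \<psi>_mem: "\<psi> u \<in> {0..1}" if "u \<in> {0..1}" for u
    using monotone_onD[OF strict_mono_on_imp_mono_on[OF mono], of 0 u]
      monotone_onD[OF strict_mono_on_imp_mono_on[OF mono], of u 1] that assms(3,4) by auto
  have "u \<in> \<psi> ` {0..1}" if "u \<in> {0..1}" for u
    using IVT'[of \<psi> 0 u 1] that assms by force
  then have range: "\<psi> ` {0..1} = {0..1}"
    using \<psi>_mem by auto
  have left: "w (\<psi> u) = u" if "u \<in> {0..1}" for u
    unfolding w_def using the_inv_into_f_f[OF inj that] .
  show ?thesis
  proof (rule that)
    show "continuous_on {0..1} w"
      using continuous_on_inv[OF cont compact_Icc] left range by auto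
    show "\<psi> (w u) = u" "w u \<in> {0..1}" if "u \<in> {0..1}" for u
      using f_the_inv_into_f[OF inj, of u] the_inv_into_into[OF inj, of u "{0..1}"] that range
      by (auto simp: w_def)
  qed (fact left \<psi>_mem)+
qed

text \<open>Write \<open>v = (1 - S ^ k) / \<theta>\<close> and \<open>H = exp (- v)\<close>. The
  factor \<open>S ^ j\<close> disappears in the limit, so inverting \<open>\<psi>\<close> gives
  \<open>H \<longlonglongrightarrow> h\<close>. Then \<open>S ^ m = exp (m / k * ln (S ^ k))\<close>
  is squeezed by the bounds 1 - 1/y \<le> ln y \<le> y - 1 at \<open>y = S ^ k\<close>, with
  \<open>m * \<theta> / k\<close> tending to \<open>s\<close>.\<close>

lemma power_limit_of_mixture_limit:
  fixes S \<theta> :: "nat \<Rightarrow> real" and m :: "nat \<Rightarrow> nat"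
  assumes \<psi>: "continuous_on {0..1} \<psi>" "strict_mono_on {0..1} \<psi>" "\<psi> 0 = 0" "\<psi> 1 = 1"
    and S: "\<And>n. S n \<in> {0..1}" and \<theta>: "\<And>n. 0 < \<theta> n" "\<theta> \<longlonglongrightarrow> 0" and "k \<ge> 1"
    and h: "h \<in> {0..1}"
    and lim: "(\<lambda>n. S n ^ j * \<psi> (exp (- ((1 - S n ^ k) / \<theta> n)))) \<longlonglongrightarrow> \<psi> h"
    and s: "0 < s" and m: "\<And>n. s \<le> real (m n) * \<theta> n / real k"
    and m_lim: "(\<lambda>n. real (m n) * \<theta> n / real k) \<longlonglongrightarrow> s"
  shows "(\<lambda>n. S n ^ m n) \<longlonglongrightarrow> h powr s"
proof -
  obtain w where w: "continuous_on {0..1} w" "\<And>u. u \<in> {0..1} \<Longrightarrow> w (\<psi> u) = u"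
    and \<psi>_mem: "\<And>u. u \<in> {0..1} \<Longrightarrow> \<psi> u \<in> {0..1}"
    using unit_interval_homeomorphism_inverse[OF \<psi>] by metis
  define v where "v n = (1 - S n ^ k) / \<theta> n" for n
  define H where "H n = exp (- v n)" for n
  have Sk: "S n ^ k \<in> {0..1}" "S n ^ j \<in> {0..1}" for n
    using S[of n] by (auto intro: power_le_one)
  have v: "0 \<le> v n" for n
    using Sk[of n] \<theta>(1)[of n] by (simp add: v_def)
  have H: "H n \<in> {0..1}" "0 < H n" for n
    using v[of n] by (auto simp: H_def)
  have \<theta>v: "\<theta> n * v n = 1 - S n ^ k" for n
    using \<theta>(1)[of n] by (simp add: v_def)
  \<comment> \<open>As \<open>k \<ge> 1\<close>, \<open>1 - S\<close> is at most
    \<open>1 - S ^ k = \<theta> * v\<close>; Bernoulli's inequality then bounds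
    \<open>1 - S ^ j\<close> by a multiple of \<open>\<theta> * v\<close>.\<close>
  have "S n ^ k \<le> S n" for n
    using S[of n] \<open>k \<ge> 1\<close> power_decreasing[of 1 k "S n"] by simp
  moreover have "1 - S n ^ j \<le> real j * (1 - S n)" for n
    using Bernoulli_inequality[of "S n - 1" j] S[of n] by (simp add: algebra_simps)
  ultimately have Sj: "1 - S n ^ j \<le> real j * (\<theta> n * v n)" for n
    unfolding \<theta>v by (meson diff_left_mono mult_left_mono of_nat_0_le_iff order_trans)
  \<comment> \<open>This is the error of dropping \<open>S ^ j\<close>. If \<open>H < d\<close>,
    then \<open>\<psi> (H)\<close> is small by continuity at 0; otherwise \<open>v\<close> is
    bounded by \<bar>ln d\<bar> and \<open>1 - S ^ j\<close> is of order
    \<open>\<theta>\<close>.\<close>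
  have "(\<lambda>n. (1 - S n ^ j) * \<psi> (H n)) \<longlonglongrightarrow> 0"
  proof (rule LIMSEQ_I)
    fix e :: real assume e: "0 < e"
    obtain d where d: "0 < d" "\<And>u. u \<in> {0..1} \<Longrightarrow> u < d \<Longrightarrow> \<psi> u < e"
    proof -
      obtain d where "d > 0" "\<forall>u\<in>{0..1}. dist u 0 < d \<longrightarrow> dist (\<psi> u) (\<psi> 0) < e"
        using \<psi>(1)[unfolded continuous_on_iff, rule_format, of 0 e] e by auto
      then show ?thesis
        using that[of d] \<psi>(3) by (force simp: dist_real_def)
    qed
    have "(\<lambda>n. real j * (\<theta> n * \<bar>ln d\<bar>)) \<longlonglongrightarrow> 0"
      using tendsto_mult[OF tendsto_const[of "real j"] tendsto_mult[OF \<theta>(2) tendsto_const[of "\<bar>ln d\<bar>"]]]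
      by simp
    then have "\<forall>\<^sub>F n in sequentially. real j * (\<theta> n * \<bar>ln d\<bar>) < e"
      using e by (rule order_tendstoD)
    then obtain n0 where n0: "\<And>n. n \<ge> n0 \<Longrightarrow> real j * (\<theta> n * \<bar>ln d\<bar>) < e"
      by (auto simp: eventually_sequentially)
    have "norm ((1 - S n ^ j) * \<psi> (H n) - 0) < e" if n: "n \<ge> n0" for n
    proof -
      note \<psi>H = \<psi>_mem[OF H(1)[of n]]
      have nonneg: "0 \<le> (1 - S n ^ j) * \<psi> (H n)"
        using Sk(2)[of n] \<psi>H by simp
      have "(1 - S n ^ j) * \<psi> (H n) < e"
      proof (cases "H n < d")
        case True
        have "(1 - S n ^ j) * \<psi> (H n) \<le> 1 * \<psi> (H n)"
          using Sk(2)[of n] \<psi>H by (intro mult_right_mono) auto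
        with d(2)[OF H(1) True] show ?thesis by simp
      next
        case False
        then have "ln d \<le> - v n"
          using d(1) ln_mono[of d "H n"] H(2)[of n] by (simp add: H_def)
        then have "v n \<le> \<bar>ln d\<bar>" by simp
        then have "real j * (\<theta> n * v n) \<le> real j * (\<theta> n * \<bar>ln d\<bar>)"
          using \<theta>(1)[of n] by (intro mult_left_mono) auto
        moreover have "(1 - S n ^ j) * \<psi> (H n) \<le> (1 - S n ^ j) * 1"
          using Sk(2)[of n] \<psi>H by (intro mult_left_mono) auto
        ultimately show ?thesis
          using Sj[of n] n0[OF n] by simp
      qed
      with nonneg show ?thesis by simp
    qed
    then show "\<exists>n0. \<forall>n\<ge>n0. norm ((1 - S n ^ j) * \<psi> (H n) - 0) < e" by blast
  qed
  from tendsto_add[OF lim this] have \<psi>H_lim: "(\<lambda>n. \<psi> (H n)) \<longlonglongrightarrow> \<psi> h"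
    by (simp add: H_def v_def algebra_simps)
  have "(\<lambda>n. w (\<psi> (H n))) \<longlonglongrightarrow> w (\<psi> h)"
    by (rule continuous_on_tendsto_compose[OF w(1) \<psi>H_lim]) (use \<psi>_mem h H in auto)
  then have H_lim: "H \<longlonglongrightarrow> h"
    using w(2) h H by simp
  have k: "0 < real k" using \<open>k \<ge> 1\<close> by simp
  have m_pos: "0 < m n" for n
    using m[of n] s k by (cases "m n = 0") auto
  have Sm: "S n ^ m n = exp (real (m n) / real k * ln (S n ^ k))" if "0 < S n" for n
    using that k by (simp add: ln_realpow exp_of_nat_mult)
  \<comment> \<open>The bound ln y \<le> y - 1 combines with
    \<open>m * \<theta> / k \<ge> s\<close>, so the upper estimate is exactly
    \<open>H powr s\<close>.\<close>
  have upper: "S n ^ m n \<le> H n powr s" for n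
  proof (cases "S n = 0")
    case True
    then show ?thesis using m_pos[of n] by (simp add: power_0_left)
  next
    case False
    then have pos: "0 < S n" "0 < S n ^ k" using S[of n] by auto
    have "real (m n) / real k * ln (S n ^ k) \<le> real (m n) / real k * (- (\<theta> n * v n))"
      using ln_le_minus_one[OF pos(2)] by (intro mult_left_mono) (auto simp: \<theta>v)
    also have "\<dots> = - (real (m n) * \<theta> n / real k * v n)"
      by simp
    also have "\<dots> \<le> - (s * v n)"
      using mult_right_mono[OF m[of n] v[of n]] by simp
    finally show ?thesis
      unfolding Sm[OF pos(1)] by (simp add: H_def powr_def)
  qed
  have upper_lim: "(\<lambda>n. H n powr s) \<longlonglongrightarrow> h powr s"
    using H_lim s H(1) by (intro tendsto_powr') auto
  show ?thesis
  proof (cases "h = 0")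
    case True
    \<comment> \<open>Here \<open>v\<close> is unbounded, but the upper estimate already tends to
      0.\<close>
    show ?thesis
    proof (rule tendsto_sandwich[OF _ _ _ upper_lim])
      show "(\<lambda>_. 0) \<longlonglongrightarrow> h powr s" using True by simp
    qed (use upper S in auto)
  next
    case False
    with h have "0 < h" by simp
    have "(\<lambda>n. - ln (H n)) \<longlonglongrightarrow> - ln h"
      using H_lim False by (intro tendsto_intros) auto
    then have v_lim: "v \<longlonglongrightarrow> - ln h"
      by (simp add: H_def)
    \<comment> \<open>For \<open>h > 0\<close> the sequence \<open>v\<close> converges, hence
      \<open>S ^ k\<close> tends to 1, and dividing by it in the lower estimate does not change the
      limit.\<close>
    have "(\<lambda>n. 1 - \<theta> n * v n) \<longlonglongrightarrow> 1 - 0 * (- ln h)"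
      by (intro tendsto_intros \<theta> v_lim)
    then have Sk_lim: "(\<lambda>n. S n ^ k) \<longlonglongrightarrow> 1"
      by (simp add: \<theta>v)
    have "(\<lambda>n. exp (- (real (m n) * \<theta> n / real k * v n / S n ^ k))) \<longlonglongrightarrow> exp (- (s * (- ln h) / 1))"
      by (intro tendsto_intros m_lim v_lim Sk_lim) auto
    then have lower_lim: "(\<lambda>n. exp (- (real (m n) * \<theta> n / real k * v n / S n ^ k))) \<longlonglongrightarrow> h powr s"
      using False by (simp add: powr_def)
    show ?thesis
    proof (rule tendsto_sandwich[OF _ _ lower_lim upper_lim])
      have "\<forall>\<^sub>F n in sequentially. 0 < S n ^ k"
        using Sk_lim by (rule order_tendstoD) simp
      then show "\<forall>\<^sub>F n in sequentially. exp (- (real (m n) * \<theta> n / real k * v n / S n ^ k)) \<le> S n ^ m n"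
      proof eventually_elim
        case (elim n)
        then have pos: "0 < S n"
          using S[of n] \<open>k \<ge> 1\<close> by (cases "S n = 0") (auto simp: power_0_left)
        have "1 - 1 / S n ^ k \<le> ln (S n ^ k)"
          using ln_le_minus_one[OF positive_imp_inverse_positive[OF elim]] ln_inverse[of "S n ^ k"]
          unfolding inverse_eq_divide by linarith
        then have "- (\<theta> n * v n / S n ^ k) \<le> ln (S n ^ k)"
          using pos by (simp add: \<theta>v diff_divide_distrib)
        then have "real (m n) / real k * (- (\<theta> n * v n / S n ^ k)) \<le> real (m n) / real k * ln (S n ^ k)"
          by (intro mult_left_mono) auto
        then show ?case
          unfolding Sm[OF pos] by simp
      qed
    qed (use upper in auto)
  qed
qed

subsection \<open>Random maxima\<close>

text \<open>With value minus infinity for the empty maximum this covers \<open>m = 0\<close>, where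
  both sides are true.\<close>

lemma vec_maximum_le_iff:
  "(\<forall>i. vec_maximum Y m \<omega> $ i \<le> ereal (x $ i)) \<longleftrightarrow> (\<forall>l\<in>{1..m}. Y l \<omega> \<le> x)"
  by (auto simp: vec_maximum_def SUP_le_iff less_eq_vec_def)

context prob_space
begin

context
  fixes Y :: "nat \<Rightarrow> 'a \<Rightarrow> real ^ 'n::finite"
  assumes indep: "indep_vars (\<lambda>_. borel) Y {1..}"
    and ident: "\<And>i. i \<ge> 1 \<Longrightarrow> distr M borel (Y i) = distr M borel (Y 1)"
begin

lemma iid_measurable: "i \<ge> 1 \<Longrightarrow> Y i \<in> borel_measurable M"
  using indep by (auto simp: indep_vars_def)

lemma iid_event: "{\<omega> \<in> space M. \<forall>l\<in>{1..m}. Y l \<omega> \<le> x} \<in> events"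
proof -
  have "{\<omega> \<in> space M. Y l \<omega> \<in> {..x}} \<in> events" if "l \<ge> 1" for l
    using iid_measurable[OF that] by measurable
  then show ?thesis
    by (intro sets.sets_Collect_finite_All) auto
qed

lemma prob_iid_all_le:
  "prob {\<omega> \<in> space M. \<forall>l\<in>{1..m}. Y l \<omega> \<le> x} = prob {\<omega> \<in> space M. Y 1 \<omega> \<le> x} ^ m"
\<comment> \<open>The product rule for independent events is applied to a non-empty index set, and
  an empty intersection would be the whole type instead of \<open>space M\<close>.\<close>
proof (cases "m = 0")
  case True
  then show ?thesis by (simp add: prob_space)
next
  case False
  have "{\<omega> \<in> space M. \<forall>l\<in>{1..m}. Y l \<omega> \<le> x} = (\<Inter>l\<in>{1..m}. Y l -` {..x} \<inter> space M)"
    using False by auto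
  also have "prob \<dots> = (\<Prod>l\<in>{1..m}. prob (Y l -` {..x} \<inter> space M))"
    using False by (intro indep_varsD[OF indep]) auto
  also have "\<dots> = (\<Prod>l\<in>{1..m}. prob {\<omega> \<in> space M. Y 1 \<omega> \<le> x})"
  proof (rule prod.cong)
    fix l assume "l \<in> {1..m}"
    then have l: "l \<ge> 1" by simp
    have "prob (Y l -` {..x} \<inter> space M) = measure (distr M borel (Y l)) {..x}"
      using iid_measurable[OF l] by (simp add: measure_distr)
    also have "\<dots> = prob (Y 1 -` {..x} \<inter> space M)"
      unfolding ident[OF l] using iid_measurable[of 1] by (simp add: measure_distr)
    also have "Y 1 -` {..x} \<inter> space M = {\<omega> \<in> space M. Y 1 \<omega> \<le> x}"
      by auto
    finally show "prob (Y l -` {..x} \<inter> space M) = prob {\<omega> \<in> space M. Y 1 \<omega> \<le> x}" .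
  qed simp
  finally show ?thesis by simp
qed

text \<open>The power is the distribution function of the maximum of \<open>m\<close> copies, which
  is real-valued as \<open>m \<ge> 1\<close>.\<close>

lemma is_joint_cdf_iid_power:
  assumes "m \<ge> 1"
  shows "is_joint_cdf (\<lambda>x. prob {\<omega> \<in> space M. Y 1 \<omega> \<le> x} ^ m)"
proof -
  define W where "W \<omega> = (\<chi> i. Max ((\<lambda>l. Y l \<omega> $ i) ` {1..m}))" for \<omega>
  have W: "W \<in> borel_measurable M"
    unfolding W_def
  proof (intro borel_measurable_vec_lambda borel_measurable_Max)
    show "(\<lambda>\<omega>. Y l \<omega> $ i) \<in> borel_measurable M" if "l \<in> {1..m}" for l i
      by (rule measurable_compose[OF iid_measurable borel_measurable_vec_nth]) (use that in simp)
  qed simp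
  have "joint_cdf (distr M borel W) x = prob {\<omega> \<in> space M. Y 1 \<omega> \<le> x} ^ m" for x
  proof -
    have "W \<omega> \<le> x \<longleftrightarrow> (\<forall>l\<in>{1..m}. Y l \<omega> \<le> x)" for \<omega>
      using assms by (auto simp: W_def less_eq_vec_def Max_le_iff)
    then have "W -` {..x} \<inter> space M = {\<omega> \<in> space M. \<forall>l\<in>{1..m}. Y l \<omega> \<le> x}"
      by auto
    then show ?thesis
      using W by (simp add: joint_cdf_def measure_distr prob_iid_all_le del: One_nat_def)
  qed
  then show ?thesis
    unfolding is_joint_cdf_def using prob_space_distr[OF W]
    by (intro exI[of _ "distr M borel W"]) auto
qed

text \<open>Split by the value of \<open>N\<close>: on {N = m} the event says that the first
  \<open>m\<close> vectors are at most \<open>x\<close>, and independence gives the term P(N = m)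
  F^m.\<close>

lemma ext_joint_cdf_random_maximum:
  assumes N: "indep_elements M (count_space UNIV) N (\<Pi>\<^sub>M i\<in>{1..}. borel) (\<lambda>\<omega>. \<lambda>i\<in>{1..}. Y i \<omega>)"
  shows "ext_joint_cdf M (\<lambda>\<omega>. vec_maximum Y (N \<omega>) \<omega>) x
    = (\<integral>\<omega>. prob {\<omega> \<in> space M. Y 1 \<omega> \<le> x} ^ N \<omega> \<partial>M)"
proof -
  define F where "F = prob {\<omega> \<in> space M. Y 1 \<omega> \<le> x}"
  have F: "0 \<le> F" "F \<le> 1" by (auto simp: F_def)
  define A where "A m = {\<omega> \<in> space M. N \<omega> = m}" for m
  define E where "E m = {\<omega> \<in> space M. \<forall>l\<in>{1..m}. Y l \<omega> \<le> x}" for m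
  have N_meas [measurable]: "N \<in> measurable M (count_space UNIV)"
    using N by (simp add: indep_elements_def)
  have A [measurable]: "A m \<in> events" for m
    unfolding A_def by measurable
  have E: "E m \<in> events" for m
    unfolding E_def by (rule iid_event)
  have prob_AE: "prob (A m \<inter> E m) = prob (A m) * F ^ m" for m
  proof -
    \<comment> \<open>Independence concerns the whole sequence, so the event \<open>E m\<close> is
      presented as the preimage of a measurable set of sequences.\<close>
    let ?B = "{y \<in> space (\<Pi>\<^sub>M i\<in>{1::nat..}. (borel :: (real ^ 'n) measure)). \<forall>l\<in>{1..m}. y l \<in> {..x}}"
    have "{y \<in> space (\<Pi>\<^sub>M i\<in>{1::nat..}. (borel :: (real ^ 'n) measure)). y l \<in> {..x}}
        \<in> sets (\<Pi>\<^sub>M i\<in>{1::nat..}. (borel :: (real ^ 'n) measure))" if "l \<in> {1..m}" for l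
      by (rule measurable_sets_Collect[OF measurable_component_singleton]) (use that in auto)
    then have "?B \<in> sets (\<Pi>\<^sub>M i\<in>{1::nat..}. (borel :: (real ^ 'n) measure))"
      by (intro sets.sets_Collect_finite_All) auto
    moreover have "E m = (\<lambda>\<omega>. \<lambda>i\<in>{1..}. Y i \<omega>) -` ?B \<inter> space M"
      by (auto simp: E_def space_PiM)
    ultimately have "E m \<in> {(\<lambda>\<omega>. \<lambda>i\<in>{1..}. Y i \<omega>) -` B \<inter> space M | B.
        B \<in> sets (\<Pi>\<^sub>M i\<in>{1::nat..}. (borel :: (real ^ 'n) measure))}"
      by blast
    moreover have "A m = N -` {m} \<inter> space M"
      by (auto simp: A_def)
    then have "A m \<in> {N -` B \<inter> space M | B. B \<in> sets (count_space UNIV)}"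
      by auto
    ultimately have "prob (A m \<inter> E m) = prob (A m) * prob (E m)"
      using N by (intro indep_setD) (auto simp: indep_elements_def)
    then show ?thesis
      by (simp add: E_def prob_iid_all_le F_def del: One_nat_def)
  qed
  have "disjoint_family (\<lambda>m. A m \<inter> E m)"
    by (auto simp: disjoint_family_on_def A_def)
  then have "(\<lambda>m. prob (A m \<inter> E m)) sums prob (\<Union>m. A m \<inter> E m)"
    using E by (intro finite_measure_UNION) auto
  moreover have "(\<Union>m. A m \<inter> E m)
      = {\<omega> \<in> space M. \<forall>i. vec_maximum Y (N \<omega>) \<omega> $ i \<le> ereal (x $ i)}"
    unfolding vec_maximum_le_iff by (auto simp: A_def E_def)
  ultimately have sums: "(\<lambda>m. prob (A m) * F ^ m) sums ext_joint_cdf M (\<lambda>\<omega>. vec_maximum Y (N \<omega>) \<omega>) x"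
    by (simp add: prob_AE ext_joint_cdf_def)
  \<comment> \<open>Only the term \<open>m = N \<omega>\<close> survives; integrating termwise
    identifies the series with the expectation of F^N.\<close>
  have pointwise: "(\<lambda>m. indicator (A m) \<omega> * F ^ m) sums F ^ N \<omega>" if "\<omega> \<in> space M" for \<omega>
  proof -
    have "(\<lambda>m. indicator (A m) \<omega> * F ^ m) = (\<lambda>m. if m = N \<omega> then F ^ m else 0)"
      using that by (auto simp: A_def indicator_def)
    then show ?thesis
      using sums_single[of "N \<omega>" "\<lambda>m. F ^ m"] by simp
  qed
  have "(\<lambda>m. \<integral>\<omega>. indicator (A m) \<omega> * F ^ m \<partial>M) sums (\<integral>\<omega>. (\<Sum>m. indicator (A m) \<omega> * F ^ m) \<partial>M)"
  proof (rule sums_integral)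
    show "integrable M (\<lambda>\<omega>. indicator (A m) \<omega> * F ^ m)" for m
      by (intro integrable_mult_left integrable_real_indicator) (auto simp: emeasure_eq_measure)
    show "AE \<omega> in M. summable (\<lambda>m. norm (indicator (A m) \<omega> * F ^ m))"
      using pointwise F by (intro AE_I2) (auto simp: sums_iff abs_mult)
    show "summable (\<lambda>m. \<integral>\<omega>. norm (indicator (A m) \<omega> * F ^ m) \<partial>M)"
      using sums F by (simp add: sums_iff abs_mult)
  qed
  also have "(\<integral>\<omega>. (\<Sum>m. indicator (A m) \<omega> * F ^ m) \<partial>M) = (\<integral>\<omega>. F ^ N \<omega> \<partial>M)"
    by (rule Bochner_Integration.integral_cong) (use pointwise in \<open>auto simp: sums_iff\<close>)
  finally show ?thesis
    using sums_unique2[OF sums] by (simp add: F_def)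
qed

end

text \<open>The endpoints are required because a distribution function may take the values 0 and 1;
  both sides are continuous on [0, 1].\<close>

lemma pgf_eq_on_closed_interval:
  fixes N :: "'a \<Rightarrow> nat" and s :: real
  assumes N [measurable]: "N \<in> measurable M (count_space UNIV)"
    and pgf: "\<And>s. 0 < s \<Longrightarrow> s < 1 \<Longrightarrow> (\<integral>\<omega>. s ^ N \<omega> \<partial>M) = g s"
    and g: "continuous_on {0..1} g"
    and s: "s \<in> {0..1}"
  shows "(\<integral>\<omega>. s ^ N \<omega> \<partial>M) = g s"
proof -
  define c where "c n = inverse (real (Suc (Suc n)))" for n
  \<comment> \<open>Moving \<open>s\<close> slightly towards 1/2 lands in the open interval at
    either end; \<open>c n < 1\<close> because the denominator starts at 2.\<close>
  define u where "u n = (1 - c n) * s + c n * (1 / 2)" for n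
  have c: "0 < c n" "c n < 1" for n
    by (auto simp: c_def divide_simps)
  have u: "0 < u n" "u n < 1" for n
  proof -
    have "0 \<le> (1 - c n) * s" "(1 - c n) * s \<le> 1 - c n"
      using s c[of n] by (auto simp: mult_left_le)
    then show "0 < u n" "u n < 1"
      using c[of n] unfolding u_def by linarith+
  qed
  have "c \<longlonglongrightarrow> 0"
    unfolding c_def using LIMSEQ_Suc[OF LIMSEQ_inverse_real_of_nat] .
  then have "u \<longlonglongrightarrow> (1 - 0) * s + 0 * (1 / 2)"
    unfolding u_def by (intro tendsto_intros)
  then have u_lim: "u \<longlonglongrightarrow> s" by simp
  have "(\<lambda>n. \<integral>\<omega>. u n ^ N \<omega> \<partial>M) \<longlonglongrightarrow> (\<integral>\<omega>. s ^ N \<omega> \<partial>M)"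
  proof (rule integral_dominated_convergence[where w = "\<lambda>_. 1"])
    show "AE \<omega> in M. (\<lambda>n. u n ^ N \<omega>) \<longlonglongrightarrow> s ^ N \<omega>"
      by (intro AE_I2 tendsto_power u_lim)
    show "AE \<omega> in M. norm (u n ^ N \<omega>) \<le> 1" for n
      using u[of n] by (intro AE_I2) (simp add: power_le_one)
  qed auto
  moreover have "(\<lambda>n. g (u n)) \<longlonglongrightarrow> g s"
    by (rule continuous_on_tendsto_compose[OF g u_lim s]) (use u in \<open>auto simp: less_imp_le\<close>)
  ultimately show ?thesis
    using pgf[OF u] LIMSEQ_unique by simp
qed

end

section \<open>Limits of randomly indexed maxima as mixtures of max-infinitely divisible
  laws\<close>

theorem theorem2:
  fixes R :: "'r measure" and Z :: "'r \<Rightarrow> real" and \<phi> :: "real \<Rightarrow> real"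
    and j k :: nat and \<Theta> :: "real set"
    and M :: "real \<Rightarrow> 'a measure"
    and Y :: "real \<Rightarrow> nat \<Rightarrow> 'a \<Rightarrow> real ^ 'n::finite"
    and N :: "real \<Rightarrow> 'a \<Rightarrow> nat"
    and \<theta> :: "nat \<Rightarrow> real" and kn :: "nat \<Rightarrow> nat"
    and Q :: "'q measure" and V :: "'q \<Rightarrow> real ^ 'n"
    and L :: "(real ^ 'n) measure"
  assumes "CARD('n) \<ge> 2"
    and "prob_space R" and "Z \<in> borel_measurable R" and "AE \<omega> in R. 0 < Z \<omega>"
    and "\<And>v. v \<ge> 0 \<Longrightarrow> \<phi> v = laplace_transform R Z v"
    and "k \<ge> 1"
    and "\<Theta> \<subseteq> {0<..}"
    and "\<And>t. t \<in> \<Theta> \<Longrightarrow> prob_space (M t)"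
    and "\<And>t. t \<in> \<Theta> \<Longrightarrow> prob_space.indep_vars (M t) (\<lambda>_. borel) (Y t) {1..}"
    and "\<And>t i. t \<in> \<Theta> \<Longrightarrow> i \<ge> 1 \<Longrightarrow> distr (M t) borel (Y t i) = distr (M t) borel (Y t 1)"
    and "\<And>t. t \<in> \<Theta> \<Longrightarrow>
           indep_elements (M t) (count_space UNIV) (N t)
             (\<Pi>\<^sub>M i\<in>{1..}. borel) (\<lambda>\<omega>. \<lambda>i\<in>{1..}. Y t i \<omega>)"
    and "\<And>t s. t \<in> \<Theta> \<Longrightarrow> 0 < s \<Longrightarrow> s < 1 \<Longrightarrow>
           (\<integral>\<omega>. s ^ N t \<omega> \<partial>M t) = s ^ j * \<phi> ((1 - s ^ k) / t)"
    and "\<And>n. \<theta> n \<in> \<Theta>" and "decseq \<theta>" and "\<theta> \<longlonglongrightarrow> 0"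
    and "\<And>n. kn n \<ge> 1"
    and "prob_space Q" and "V \<in> borel_measurable Q"
    and "max_inf_divisible (joint_cdf (distr Q borel V))"
    and "cdf_converges (\<lambda>n. ext_joint_cdf (M (\<theta> n)) (vec_maximum (Y (\<theta> n)) (kn n)))
           (joint_cdf (distr Q borel V))"
    and "prob_space L" and "sets L = sets borel"
    and "cdf_converges
           (\<lambda>n. ext_joint_cdf (M (\<theta> n)) (\<lambda>\<omega>. vec_maximum (Y (\<theta> n)) (N (\<theta> n) \<omega>) \<omega>))
           (joint_cdf L)"
  shows "\<exists>H. max_inf_divisible H \<and> joint_cdf L = laplace_mixture \<phi> H"
proof -
  note R = assms(2-4) and \<phi> = assms(5) and k = assms(6) and iid = assms(8-10) and N = assms(11)
    and pgf = assms(12) and \<theta>_mem = assms(13) and \<theta>_lim = assms(15) and L = assms(21,22) and lim = assms(23)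
  interpret R: prob_space R by (rule R(1))
  define \<psi> where "\<psi> u = (\<integral>\<omega>. u powr Z \<omega> \<partial>R)" for u
  have \<psi>: "continuous_on {0..1} \<psi>" "strict_mono_on {0..1} \<psi>" "\<psi> 0 = 0" "\<psi> 1 = 1"
    unfolding \<psi>_def using continuous_on_integral_powr[OF R] strict_mono_on_integral_powr[OF R]
    by (simp_all add: R.prob_space)
  have \<phi>_eq: "\<phi> v = \<psi> (exp (- v))" if "0 \<le> v" for v
    using \<phi>[OF that] by (simp add: \<psi>_def laplace_transform_eq_integral_powr)
  obtain w where w: "continuous_on {0..1} w" "\<And>u. u \<in> {0..1} \<Longrightarrow> w (\<psi> u) = u"
    "\<And>u. u \<in> {0..1} \<Longrightarrow> \<psi> (w u) = u" "\<And>u. u \<in> {0..1} \<Longrightarrow> w u \<in> {0..1}"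
    using unit_interval_homeomorphism_inverse[OF \<psi>] by metis
  have w01: "w 0 = 0" "w 1 = 1"
    using w(2)[of 0] w(2)[of 1] \<psi>(3,4) by auto
  have \<theta>_pos: "0 < \<theta> n" for n
    using \<theta>_mem[of n] assms(7) by auto
  define G where "G = joint_cdf L"
  have G: "G x \<in> {0..1}" for x
    using joint_cdf_bounds[OF L] by (simp add: G_def)
  define F where "F n x = measure (M (\<theta> n)) {\<omega> \<in> space (M (\<theta> n)). Y (\<theta> n) 1 \<omega> \<le> x}" for n x
  have F: "F n x \<in> {0..1}" for n x
    using prob_space.prob_le_1[OF iid(1)[OF \<theta>_mem]] by (simp add: F_def)
  \<comment> \<open>The prescribed generating function, extended to the closed interval, is
    evaluated at the distribution function \<open>F n\<close> of a single vector.\<close>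
  have random_max: "ext_joint_cdf (M (\<theta> n)) (\<lambda>\<omega>. vec_maximum (Y (\<theta> n)) (N (\<theta> n) \<omega>) \<omega>) x
      = F n x ^ j * \<psi> (exp (- ((1 - F n x ^ k) / \<theta> n)))" for n x
  proof -
    let ?M = "M (\<theta> n)" and ?g = "\<lambda>s. s ^ j * \<psi> (exp (- ((1 - s ^ k) / \<theta> n)))"
    interpret prob_space ?M by (rule iid(1)[OF \<theta>_mem])
    have arg: "0 \<le> (1 - s ^ k) / \<theta> n" if "s \<in> {0..1}" for s
      using that \<theta>_pos[of n] by (simp add: power_le_one)
    have g_cont: "continuous_on {0..1} ?g"
    proof (intro continuous_on_mult continuous_on_compose2[OF \<psi>(1)])
      show "continuous_on {0..1} (\<lambda>s. exp (- ((1 - s ^ k) / \<theta> n)))"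
        using \<theta>_pos[of n] by (intro continuous_intros) auto
      show "(\<lambda>s. exp (- ((1 - s ^ k) / \<theta> n))) ` {0..1} \<subseteq> {0..1}"
        using arg by auto
    qed (intro continuous_intros)
    have N_meas: "N (\<theta> n) \<in> measurable ?M (count_space UNIV)"
      using N[OF \<theta>_mem] by (simp add: indep_elements_def)
    have pgf_eq: "(\<integral>\<omega>. s ^ N (\<theta> n) \<omega> \<partial>?M) = ?g s" if "0 < s" "s < 1" for s
      using pgf[OF \<theta>_mem that] \<phi>_eq[OF arg] that by simp
    have "ext_joint_cdf ?M (\<lambda>\<omega>. vec_maximum (Y (\<theta> n)) (N (\<theta> n) \<omega>) \<omega>) x
        = (\<integral>\<omega>. F n x ^ N (\<theta> n) \<omega> \<partial>?M)"
      unfolding F_def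
      by (rule ext_joint_cdf_random_maximum[OF iid(2)[OF \<theta>_mem] iid(3)[OF \<theta>_mem] N[OF \<theta>_mem]])
    also have "\<dots> = ?g (F n x)"
      by (rule pgf_eq_on_closed_interval[OF N_meas pgf_eq g_cont F])
    finally show ?thesis .
  qed
  have cdf_power: "is_joint_cdf (\<lambda>x. w (G x) powr s)" if s: "0 < s" for s
  proof -
    \<comment> \<open>Rounding up makes \<open>m * \<theta> / k\<close> at least \<open>s\<close>,
      with excess at most \<open>\<theta> / k\<close>, and ensures \<open>m \<ge> 1\<close>.\<close>
    define m where "m n = nat \<lceil>s * real k / \<theta> n\<rceil>" for n
    have pos: "0 < s * real k / \<theta> n" for n
      using s k \<theta>_pos[of n] by simp
    have m: "s * real k / \<theta> n \<le> real (m n)" "real (m n) \<le> s * real k / \<theta> n + 1" for n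
      using pos[of n] unfolding m_def by linarith+
    have m_lower: "s \<le> real (m n) * \<theta> n / real k" for n
      using m(1)[of n] k \<theta>_pos[of n] by (simp add: field_simps)
    have m_upper: "real (m n) * \<theta> n / real k \<le> s + \<theta> n / real k" for n
      using m(2)[of n] k \<theta>_pos[of n] by (simp add: field_simps)
    have "(\<lambda>n. s + \<theta> n / real k) \<longlonglongrightarrow> s + 0 / real k"
      using k by (intro tendsto_intros \<theta>_lim) simp
    then have "(\<lambda>n. s + \<theta> n / real k) \<longlonglongrightarrow> s" by simp
    with tendsto_const[of s] have m_lim: "(\<lambda>n. real (m n) * \<theta> n / real k) \<longlonglongrightarrow> s"
      by (rule tendsto_sandwich[rotated 2]) (intro always_eventually allI m_lower m_upper)+
    have "is_joint_cdf (\<lambda>x. w (joint_cdf L x) powr s)"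
    proof (rule is_joint_cdf_transform_limit[OF _ L])
      show "is_joint_cdf (\<lambda>x. F n x ^ m n)" for n
      proof -
        have "m n \<ge> 1"
          using m(1)[of n] pos[of n] by (cases "m n = 0") auto
        then show ?thesis
          unfolding F_def
          by (intro prob_space.is_joint_cdf_iid_power iid \<theta>_mem)
      qed
      show "continuous_on {0..1} (\<lambda>u. w u powr s)"
        using w(1,4) s by (intro continuous_on_powr') auto
      show "(\<lambda>n. F n x ^ m n) \<longlonglongrightarrow> w (joint_cdf L x) powr s" if x: "isCont (joint_cdf L) x" for x
      proof (rule power_limit_of_mixture_limit[OF \<psi> F \<theta>_pos \<theta>_lim k _ _ s m_lower m_lim])
        show "w (joint_cdf L x) \<in> {0..1}"
          using w(4) G by (simp add: G_def)
        have "(\<lambda>n. F n x ^ j * \<psi> (exp (- ((1 - F n x ^ k) / \<theta> n)))) \<longlonglongrightarrow> joint_cdf L x"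
          using lim x unfolding cdf_converges_def random_max by blast
        then show "(\<lambda>n. F n x ^ j * \<psi> (exp (- ((1 - F n x ^ k) / \<theta> n)))) \<longlonglongrightarrow> \<psi> (w (joint_cdf L x))"
          using w(3) G by (simp add: G_def)
      qed
    qed (use w01 s in auto)
    then show ?thesis by (simp add: G_def)
  qed
  define H where "H x = w (G x)" for x
  have H: "H x \<in> {0..1}" "\<psi> (H x) = G x" for x
    using w(3,4) G by (auto simp: H_def)
  have "max_inf_divisible H"
  proof -
    \<comment> \<open>Since \<open>H\<close> is non-negative, the case \<open>s = 1\<close> shows
      that \<open>H\<close> itself is a distribution function.\<close>
    have "(\<lambda>x. w (G x) powr 1) = H"
      using H(1) by (auto simp: H_def)
    then show ?thesis
      using cdf_power[of 1] cdf_power unfolding max_inf_divisible_def H_def by simp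
  qed
  moreover have "joint_cdf L = laplace_mixture \<phi> H"
  proof
    fix x
    show "joint_cdf L x = laplace_mixture \<phi> H x"
    \<comment> \<open>Where \<open>H\<close> vanishes, the convention of
      \<open>laplace_mixture\<close> agrees with \<open>\<psi> 0 = 0\<close>.\<close>
    proof (cases "H x = 0")
      case True
      then show ?thesis
        using H(2)[of x] \<psi>(3) by (simp add: laplace_mixture_def G_def)
    next
      case False
      then have "0 < H x" "H x \<le> 1" using H(1)[of x] by auto
      then have "\<phi> (- ln (H x)) = \<psi> (H x)"
        using \<phi>_eq[of "- ln (H x)"] by simp
      then show ?thesis
        using False H(2)[of x] by (simp add: laplace_mixture_def G_def)
    qed
  qed
  ultimately show ?thesis by blast
qed

end
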